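(* Assume $\mathfrak{ap}=\mathfrak{c}$. Then there exists a pseudocompact MAD family, i.e. a MAD family $\mathcal A$ on $\omega$ such that the Vietoris hyperspace $\exp(\Psi(\mathcal A))$ is a pseudocompact space.
   Context: An almost disjoint family (on $\omega$) is an infinite set $\mathcal A$ of infinite subsets of $\omega$ such that $a\cap b$ is finite for all distinct $a,b\in\mathcal A$. A MAD family is an almost disjoint family not properly contained in any other almost disjoint family. $\Psi(\mathcal A)$ is the set $\omega\cup\mathcal A$ with the topology having base $\{\{n\}:n\in\omega\}\cup\{\{a\}\cup(a\setminus F): a\in\mathcal A,\ F\in[\omega]^{<\omega}\}$. For a $T_1$ space $X$, $\exp(X)$ is the set of all nonempty closed subsets of $X$ with the Vietoris topology, generated by the subbase of all sets $U^+=\{F\in\exp(X):F\subseteq U\}$ and $U^-=\{F\in\exp(X):F\cap U\ne\emptyset\}$ with $U\subseteq X$ open. A space is pseudocompact if every continuous real-valued function on it is bounded. An almost disjoint family $\mathcal A$ is called pseudocompact if $\exp(\Psi(\mathcal A))$ is pseudocompact. $\mathfrak{c}=2^{\aleph_0}$. The cardinal $\mathfrak{ap}$ is the least size of an almost disjoint family $\mathcal A$ that contains a subfamily $\mathcal B\subseteq\mathcal A$ for which there is no $X\subseteq\omega$ such that $|X\cap a|<\omega$ for every $a\in\mathcal A\setminus\mathcal B$ and $|X\cap a|=\omega$ for every $a\in\mathcal B$. *)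

theory Defs
  imports "HOL-Analysis.Analysis"
begin

unbundle cardinal_syntax

definition almost_disjoint_family :: "nat set set \<Rightarrow> bool" where
  "almost_disjoint_family A \<longleftrightarrow>
     infinite A \<and> (\<forall>a\<in>A. infinite a) \<and> (\<forall>a\<in>A. \<forall>b\<in>A. a \<noteq> b \<longrightarrow> finite (a \<inter> b))"

definition MAD_family :: "nat set set \<Rightarrow> bool" where
  "MAD_family A \<longleftrightarrow>
     almost_disjoint_family A \<and> \<not> (\<exists>B. almost_disjoint_family B \<and> A \<subset> B)"

text \<open>The points of the space are tagged: \<open>Inl n\<close> for natural numbers, \<open>Inr a\<close> for members of
  the family, so the union of \<open>\<omega>\<close> and \<open>A\<close> is a disjoint one.\<close>

definition Psi_base :: "nat set set \<Rightarrow> (nat + nat set) set set" where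
  "Psi_base A = {{Inl n} | n. True} \<union> {{Inr a} \<union> Inl ` (a - F) | a F. a \<in> A \<and> finite F}"

definition Psi :: "nat set set \<Rightarrow> (nat + nat set) topology" where
  "Psi A = topology_generated_by (Psi_base A)"

definition hyperspace :: "'a topology \<Rightarrow> 'a set set" where
  "hyperspace X = {F. closedin X F \<and> F \<noteq> {}}"

definition Vietoris :: "'a topology \<Rightarrow> 'a set topology" where
  "Vietoris X = topology_generated_by
     ({{F \<in> hyperspace X. F \<subseteq> U} | U. openin X U} \<union>
      {{F \<in> hyperspace X. F \<inter> U \<noteq> {}} | U. openin X U})"

definition pseudocompact_space :: "'a topology \<Rightarrow> bool" where
  "pseudocompact_space X \<longleftrightarrow>
     (\<forall>f. continuous_map X euclideanreal f \<longrightarrow> bounded (f ` topspace X))"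

definition unseparable_family :: "nat set set \<Rightarrow> bool" where
  "unseparable_family A \<longleftrightarrow>
     almost_disjoint_family A \<and>
     (\<exists>B\<subseteq>A. \<not> (\<exists>X. (\<forall>a\<in>A - B. finite (X \<inter> a)) \<and> (\<forall>a\<in>B. infinite (X \<inter> a))))"

text \<open>Cardinals are represented by cardinal orders up to \<open>=o\<close>.  That the choice below has a
  witness is the lemma \<open>ap_least\<close>.\<close>

definition ap :: "nat set rel" where
  "ap = (SOME \<kappa>. (\<exists>A. unseparable_family A \<and> \<kappa> = |A| ) \<and>
                (\<forall>B. unseparable_family B \<longrightarrow> \<kappa> \<le>o |B| ))"

definition continuum :: "(nat \<Rightarrow> bool) rel" where
  "continuum = ctwo ^c natLeq"

lemma pseudocompact_space_iff:
  "pseudocompact_space X \<longleftrightarrow>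
     (\<forall>f. continuous_map X euclideanreal f \<longrightarrow> (\<exists>M. \<forall>x\<in>topspace X. \<bar>f x\<bar> \<le> M))"
  unfolding pseudocompact_space_def bounded_iff by simp

lemma topspace_Psi: "topspace (Psi A) = range Inl \<union> Inr ` A"
proof -
  have "\<Union> (Psi_base A) = range Inl \<union> Inr ` A"
  proof (intro equalityI subsetI)
    fix x assume "x \<in> \<Union> (Psi_base A)"
    then show "x \<in> range Inl \<union> Inr ` A" by (auto simp: Psi_base_def)
  next
    fix x :: "nat + nat set"
    assume "x \<in> range Inl \<union> Inr ` A"
    then consider n where "x = Inl n" | a where "a \<in> A" "x = Inr a" by blast
    then show "x \<in> \<Union> (Psi_base A)"
    proof cases
      case (1 n)
      have "{Inl n} \<in> Psi_base A" unfolding Psi_base_def by blast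
      then show ?thesis using 1 by blast
    next
      case (2 a)
      then have "{Inr a} \<union> Inl ` (a - {}) \<in> Psi_base A" unfolding Psi_base_def by blast
      then show ?thesis using 2 by blast
    qed
  qed
  then show ?thesis by (simp add: Psi_def)
qed

lemma openin_Psi:
  "openin (Psi A) = arbitrary union_of (\<lambda>V. V \<in> Psi_base A)"
proof -
  have local_base: "\<exists>V\<in>Psi_base A. x \<in> V \<and> V \<subseteq> S \<inter> T"
    if "S \<in> Psi_base A" "T \<in> Psi_base A" "x \<in> S \<inter> T" for S T x
  proof (cases x)
    case (Inl n)
    then show ?thesis using that by (intro bexI[of _ "{Inl n}"]) (auto simp: Psi_base_def)
  next
    case (Inr a)
    with that obtain F G where *: "a \<in> A" "finite F" "finite G"
      "S = {Inr a} \<union> Inl ` (a - F)" "T = {Inr a} \<union> Inl ` (a - G)"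
      by (auto simp: Psi_base_def)
    from * have "{Inr a} \<union> Inl ` (a - (F \<union> G)) \<in> Psi_base A"
      unfolding Psi_base_def using finite_UnI by blast
    then show ?thesis using Inr *
      by (intro bexI[of _ "{Inr a} \<union> Inl ` (a - (F \<union> G))"]) auto
  qed
  have "\<exists>V\<in>Psi_base A. x \<in> V \<and> V \<subseteq> U"
    if "generate_topology_on (Psi_base A) U" "x \<in> U" for U x
    using that
  proof (induction arbitrary: x)
    case (Int S T)
    then obtain V W where "V \<in> Psi_base A" "x \<in> V" "V \<subseteq> S" "W \<in> Psi_base A" "x \<in> W" "W \<subseteq> T"
      by (meson IntD1 IntD2)
    then show ?case using local_base[of V W x] by blast
  next
    case (UN K)
    then obtain k where "k \<in> K" "x \<in> k" by blast
    then show ?case using UN.IH[of k x] by blast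
  next
    case (Basis S)
    then show ?case by blast
  qed simp
  then show ?thesis
    unfolding openin_topology_base_unique
    by (metis Psi_def openin_topology_generated_by topology_generated_by_Basis)
qed

lemma topspace_Vietoris: "topspace (Vietoris X) = hyperspace X"
proof -
  have "{F \<in> hyperspace X. F \<subseteq> topspace X} = hyperspace X"
    by (auto simp: hyperspace_def dest: closedin_subset)
  then have "hyperspace X \<in> {{F \<in> hyperspace X. F \<subseteq> U} | U. openin X U}"
    by (intro CollectI exI[of _ "topspace X"]) simp
  then show ?thesis
    unfolding Vietoris_def topology_generated_by_topspace by (intro equalityI subsetI) auto
qed

lemma continuum_eq: "continuum =o |UNIV :: nat set set|"
  unfolding continuum_def BNF_Cardinal_Arithmetic.cexp_def BNF_Cardinal_Arithmetic.ctwo_def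
    Field_natLeq Field_card_of
  using card_of_Pow_Func[of "UNIV :: nat set"] by (simp add: ordIso_symmetric)

lemma unseparable_family_exists: "\<exists>A. unseparable_family A"
proof -
  define code where "code S n = prod_encode (n, set_encode (S \<inter> {..<n}))" for S :: "nat set" and n
  define A where "A = range (\<lambda>S. range (code S))"
  have code_eq: "n = m \<and> S \<inter> {..<n} = T \<inter> {..<n}" if "code S n = code T m" for S T n m
    using that set_encode_eq[of "S \<inter> {..<n}" "T \<inter> {..<m}"]
    by (auto simp: code_def)
  have inj_code: "inj (code S)" for S
    using code_eq by (meson injI)
  have inj_branch: "inj (\<lambda>S. range (code S))"
  proof (rule injI)
    fix S T assume eq: "range (code S) = range (code T)"
    have "S \<inter> {..<n} = T \<inter> {..<n}" for n
      using eq code_eq by (metis rangeE rangeI)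
    then show "S = T" by (metis Int_iff lessI lessThan_iff set_eqI)
  qed
  have fin: "finite (range (code S) \<inter> range (code T))" if "S \<noteq> T" for S T
  proof -
    obtain k where k: "(k \<in> S) \<noteq> (k \<in> T)" using \<open>S \<noteq> T\<close> by blast
    have "range (code S) \<inter> range (code T) \<subseteq> code S ` {..k}"
    proof
      fix x assume "x \<in> range (code S) \<inter> range (code T)"
      then obtain n m where x: "x = code S n" "x = code T m" by blast
      then have "S \<inter> {..<n} = T \<inter> {..<n}" using code_eq by metis
      then have "n \<le> k" using k by (metis Int_iff lessThan_iff not_le)
      then show "x \<in> code S ` {..k}" using x by blast
    qed
    then show ?thesis using finite_subset by blast
  qed
  have ad: "almost_disjoint_family A"
    unfolding almost_disjoint_family_def
  proof (intro conjI ballI impI)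
    have "infinite (UNIV :: nat set set)" by (simp add: Finite_Set.finite_set)
    then show "infinite A" unfolding A_def using inj_branch finite_imageD by blast
    show "infinite a" if "a \<in> A" for a
      using that inj_code by (auto simp: A_def range_inj_infinite)
    show "finite (a \<inter> b)" if "a \<in> A" "b \<in> A" "a \<noteq> b" for a b
    proof -
      obtain S T where "a = range (code S)" "b = range (code T)"
        using \<open>a \<in> A\<close> \<open>b \<in> A\<close> by (auto simp: A_def)
      then show ?thesis using fin[of S T] \<open>a \<noteq> b\<close> by blast
    qed
  qed
  have "unseparable_family A"
  proof (rule ccontr)
    assume "\<not> unseparable_family A"
    then have sep: "\<exists>X. (\<forall>a\<in>A - B. finite (X \<inter> a)) \<and> (\<forall>a\<in>B. infinite (X \<inter> a))"
      if "B \<subseteq> A" for B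
      using ad that by (auto simp: unseparable_family_def)
    define D where "D = {S. finite (S \<inter> range (code S))}"
    have "(\<lambda>S. range (code S)) ` D \<subseteq> A" by (auto simp: A_def)
    from sep[OF this] obtain X where
      X: "(\<forall>a\<in>A - (\<lambda>S. range (code S)) ` D. finite (X \<inter> a)) \<and>
         (\<forall>a\<in>(\<lambda>S. range (code S)) ` D. infinite (X \<inter> a))" ..
    show False
    proof (cases "X \<in> D")
      case True
      then have "infinite (X \<inter> range (code X))"
        by (intro bspec[OF conjunct2[OF X]] imageI)
      then show False using True D_def by simp
    next
      case False
      then have "range (code X) \<notin> (\<lambda>S. range (code S)) ` D"
        using inj_branch by (auto dest: injD)
      then have "finite (X \<inter> range (code X))"
        by (intro bspec[OF conjunct1[OF X]]) (simp add: A_def)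
      then show False using False D_def by simp
    qed
  qed
  then show ?thesis by blast
qed

lemma ap_least:
  "(\<exists>A. unseparable_family A \<and> ap = |A| ) \<and> (\<forall>B. unseparable_family B \<longrightarrow> ap \<le>o |B| )"
proof -
  have "\<exists>\<kappa>\<in>card_of ` Collect unseparable_family. \<forall>\<mu>\<in>card_of ` Collect unseparable_family. \<kappa> \<le>o \<mu>"
    using unseparable_family_exists
    by (intro exists_minim_Card_order) (auto simp: card_of_Card_order)
  then have "\<exists>\<kappa>. (\<exists>A. unseparable_family A \<and> \<kappa> = |A| ) \<and>
      (\<forall>B. unseparable_family B \<longrightarrow> \<kappa> \<le>o |B| )"
    by blast
  then show ?thesis unfolding ap_def by (rule someI_ex)
qed

end

theory Submission
  imports Defs
begin

text \<open>
  The finite subsets of \<open>\<omega>\<close> are dense in the hyperspace of \<open>\<Psi>(A)\<close>, so it is pseudocompact once every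
  sequence of finite sets has an accumulation point, and it suffices to treat pairwise disjoint
  sequences \<open>C\<close>. Along an ultrafilter \<open>p\<close> the only candidate limit of \<open>C\<close> is \<open>L = {a \<in> A. {n. C n \<inter> a \<noteq> {}} \<in> p}\<close>,
  and it is a limit iff every \<open>Y\<close> that meets \<open>p\<close>-many \<open>C n\<close> meets some \<open>a \<in> L\<close> infinitely.
  Therefore \<open>A\<close> is built together with a filter base \<open>p C\<close> for each \<open>C\<close> by a recursion of length continuum:
  at the stage of \<open>(C, Y)\<close> we put \<open>{n. C n \<inter> Y = {}}\<close> into \<open>p C\<close> if possible, and otherwise
  add to \<open>A\<close> a subset of \<open>Y\<close> that meets the members of each set of \<open>p C\<close> infinitely often and is almost disjoint
  from the previous elements. Such a subset exists because fewer than \<open>\<aa>\<pp>\<close> sets are involved: \<open>p C\<close> induces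
  a filter on \<open>\<omega>\<close> containing the complements of the relevant elements of \<open>A\<close>; one refines it to an
  almost disjoint family orthogonal to \<open>A\<close> and separates this family from \<open>A\<close>.
  Maximality of \<open>A\<close> is the case of singletons \<open>C n\<close>.\<close>


section \<open>Small sets, almost disjointness and orthogonality\<close>

definition small :: "'a set \<Rightarrow> bool" where
  "small A \<longleftrightarrow> |A| <o |UNIV :: nat set set|"

text \<open>Unlike \<open>almost_disjoint_family\<close> this admits finite families: the recursion
  starts from the empty one.\<close>

definition ad :: "nat set set \<Rightarrow> bool" where
  "ad A \<longleftrightarrow> (\<forall>a\<in>A. infinite a) \<and> (\<forall>a\<in>A. \<forall>b\<in>A. a \<noteq> b \<longrightarrow> finite (a \<inter> b))"

lemma ad_infinite: "ad A \<Longrightarrow> a \<in> A \<Longrightarrow> infinite a"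
  by (simp add: ad_def)

lemma ad_finite: "ad A \<Longrightarrow> a \<in> A \<Longrightarrow> b \<in> A \<Longrightarrow> a \<noteq> b \<Longrightarrow> finite (a \<inter> b)"
  by (simp add: ad_def)

definition orthog :: "nat set \<Rightarrow> nat set set \<Rightarrow> bool" where
  "orthog X A \<longleftrightarrow> (\<forall>a\<in>A. finite (X \<inter> a))"

subsection \<open>Small cardinals\<close>

lemma infinite_UNIV_nat_set: "infinite (UNIV :: nat set set)"
  by (simp add: Finite_Set.finite_set)

lemma small_finite: "finite A \<Longrightarrow> small A"
  unfolding small_def using finite_ordLess_infinite[OF card_of_Well_order card_of_Well_order]
    infinite_UNIV_nat_set by (simp add: Field_card_of)

lemma small_ordLeq: "|A| \<le>o |B| \<Longrightarrow> small B \<Longrightarrow> small A"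
  unfolding small_def by (rule ordLeq_ordLess_trans)

lemma small_subset: "A \<subseteq> B \<Longrightarrow> small B \<Longrightarrow> small A"
  by (rule small_ordLeq[OF card_of_mono1])

lemma small_image: "small A \<Longrightarrow> small (f ` A)"
  by (rule small_ordLeq[OF card_of_image])

lemma small_Un: "small A \<Longrightarrow> small B \<Longrightarrow> small (A \<union> B)"
  unfolding small_def by (rule card_of_Un_ordLess_infinite[OF infinite_UNIV_nat_set])

lemma card_of_finite_ordLeq: "finite A \<Longrightarrow> infinite B \<Longrightarrow> |A| \<le>o |B|"
  by (blast intro: ordLess_imp_ordLeq dest: finite_ordLess_infinite[OF card_of_Well_order card_of_Well_order, unfolded Field_card_of])

text \<open>An infinite index set absorbs finite pieces. Each stage of the recursion contributes
  only finitely many sets, so all that is added before a given stage is small.\<close>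

lemma small_UN_finite:
  assumes "small I" and "\<And>i. i \<in> I \<Longrightarrow> finite (F i)"
  shows "small (\<Union>i\<in>I. F i)"
proof (cases "finite I")
  case True
  then show ?thesis using assms(2) by (intro small_finite) blast
next
  case False
  then have "|\<Union>i\<in>I. F i| \<le>o |I|"
    using assms(2) by (intro card_of_UNION_ordLeq_infinite) (auto intro: card_of_finite_ordLeq ordIso_imp_ordLeq[OF card_of_refl])
  then show ?thesis using small_ordLeq assms(1) by blast
qed

text \<open>For infinite \<open>A\<close>, the subsets of size at most \<open>n + 1\<close> arise by
  inserting an element into those of size at most \<open>n\<close>, and a countable union adds
  nothing. This counts the finite intersections from a filter base.\<close>

lemma small_Fpow:
  assumes "small A"
  shows "small (Fpow A)"
proof (cases "finite A")
  case True
  then show ?thesis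
    by (intro small_finite) (auto simp: Fpow_Pow_finite)
next
  case inf: False
  define S where "S n = {T. T \<subseteq> A \<and> finite T \<and> card T \<le> n}" for n
  have "|S n| \<le>o |A|" for n
  proof (induction n)
    case 0
    have "S 0 = {{}}" by (auto simp: S_def)
    then show ?case using inf by (auto intro: card_of_finite_ordLeq)
  next
    case (Suc n)
    have "S (Suc n) \<subseteq> insert {} ((\<lambda>(x, T). insert x T) ` (A \<times> S n))"
    proof
      fix T assume T: "T \<in> S (Suc n)"
      show "T \<in> insert {} ((\<lambda>(x, T). insert x T) ` (A \<times> S n))"
      proof (cases "T = {}")
        case False
        then obtain x where "x \<in> T" by blast
        then have "(x, T - {x}) \<in> A \<times> S n" "T = (\<lambda>(x, T). insert x T) (x, T - {x})"
          using T by (auto simp: S_def)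
        then show ?thesis by (intro insertI2) (rule image_eqI)
      qed simp
    qed
    moreover have "|insert {} ((\<lambda>(x, T). insert x T) ` (A \<times> S n))| \<le>o |A|"
    proof -
      have "|A \<times> S n| \<le>o |A|"
        using card_of_Times_ordLeq_infinite_Field[OF _ ordIso_imp_ordLeq[OF card_of_refl] Suc card_of_Card_order]
          inf by (simp add: Field_card_of)
      then have "|(\<lambda>(x, T). insert x T) ` (A \<times> S n)| \<le>o |A|"
        using card_of_image ordLeq_transitive by blast
      moreover have "|{{}} :: 'a set set| \<le>o |A|" using inf by (auto intro: card_of_finite_ordLeq)
      ultimately have "|{{}} \<union> (\<lambda>(x, T). insert x T) ` (A \<times> S n)| \<le>o |A|"
        using inf by (intro card_of_Un_ordLeq_infinite_Field) (auto simp: Field_card_of card_of_card_order_on)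
      then show ?thesis by simp
    qed
    ultimately show ?case by (rule ordLeq_transitive[OF card_of_mono1])
  qed
  then have "|\<Union>n\<in>UNIV. S n| \<le>o |A|"
    using inf by (intro card_of_UNION_ordLeq_infinite) (auto simp: infinite_iff_card_of_nat)
  moreover have "Fpow A \<subseteq> (\<Union>n\<in>UNIV. S n)" by (auto simp: Fpow_def S_def)
  ultimately show ?thesis by (meson small_subset small_ordLeq assms)
qed

text \<open>A well-order of type continuum.\<close>

definition below :: "nat set rel" where
  "below = |UNIV :: nat set set| - Id"

lemma wf_below: "wf below"
  unfolding below_def
  using card_of_Well_order[of "UNIV :: nat set set"] by (simp add: well_order_on_def)

text \<open>A cardinal order is an initial ordinal, so fewer than continuum many stages precede any
  given one.\<close>

lemma small_below: "small {j. (j, i) \<in> below}"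
proof -
  have "{j. (j, i) \<in> below} = underS |UNIV :: nat set set| i"
    by (auto simp: below_def underS_def)
  then show ?thesis unfolding small_def
    using card_of_underS[OF card_of_Card_order, of i "UNIV :: nat set set"] by (simp add: Field_card_of)
qed

lemma below_trans: "(i, j) \<in> below \<Longrightarrow> (j, k) \<in> below \<Longrightarrow> (i, k) \<in> below"
  using card_of_Well_order[of "UNIV :: nat set set"]
  by (auto simp: below_def well_order_on_def linear_order_on_def partial_order_on_def
      preorder_on_def antisym_def dest: transD)

lemma below_total: "i = j \<or> (i, j) \<in> below \<or> (j, i) \<in> below"
  using card_of_Well_order[of "UNIV :: nat set set"]
  unfolding below_def well_order_on_def linear_order_on_def total_on_def by (auto simp: Field_card_of)

subsection \<open>Separation of small almost disjoint families\<close>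

lemma finite_inter_Union: "finite T \<Longrightarrow> (\<And>a. a \<in> T \<Longrightarrow> finite (X \<inter> a)) \<Longrightarrow> finite (X \<inter> \<Union>T)"
  unfolding Int_Union by (rule finite_UN_I)

locale ap_eq_continuum =
  assumes ap_continuum: "ap =o continuum"
begin

text \<open>For infinite \<open>A\<close> a failure would contradict the minimality of
  \<open>ap\<close>. The definition of \<open>ap\<close> does not speak of finite families; there
  the complement of \<open>\<Union>(A - B)\<close> separates.\<close>

lemma separation:
  assumes "ad A" "small A" "B \<subseteq> A"
  obtains X where "\<And>a. a \<in> A - B \<Longrightarrow> finite (X \<inter> a)" "\<And>a. a \<in> B \<Longrightarrow> infinite (X \<inter> a)"
proof (cases "finite A")
  case True
  define X where "X = - \<Union>(A - B)"
  have "infinite (X \<inter> a)" if "a \<in> B" for a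
  proof -
    have "finite (a \<inter> \<Union>(A - B))"
    proof (rule finite_inter_Union)
      show "finite (A - B)" using True by simp
      show "finite (a \<inter> a')" if "a' \<in> A - B" for a'
        using that \<open>a \<in> B\<close> assms(3) by (intro ad_finite[OF assms(1)]) auto
    qed
    moreover have "infinite a" using \<open>a \<in> B\<close> assms(3) by (intro ad_infinite[OF assms(1)]) auto
    ultimately have "infinite (a - a \<inter> \<Union>(A - B))" by (rule Diff_infinite_finite)
    moreover have "X \<inter> a = a - a \<inter> \<Union>(A - B)" unfolding X_def by blast
    ultimately show ?thesis by simp
  qed
  moreover have "finite (X \<inter> a)" if "a \<in> A - B" for a
  proof -
    have "X \<inter> a = {}" using that by (auto simp: X_def)
    then show ?thesis by simp
  qed
  ultimately show thesis by (rule that[rotated])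
next
  case False
  have "\<not> unseparable_family A"
  proof
    assume "unseparable_family A"
    then have "ap \<le>o |A|" using ap_least by blast
    moreover have "|A| <o continuum"
      using assms(2) ordIso_symmetric[OF continuum_eq] unfolding small_def
      by (rule ordLess_ordIso_trans)
    then have "|A| <o ap" using ordIso_symmetric[OF ap_continuum] by (rule ordLess_ordIso_trans)
    ultimately show False using not_ordLess_ordLeq by blast
  qed
  moreover have "almost_disjoint_family A"
    using False assms(1) by (simp add: almost_disjoint_family_def ad_def)
  ultimately obtain X where "\<forall>a\<in>A - B. finite (X \<inter> a)" "\<forall>a\<in>B. infinite (X \<inter> a)"
    using assms(3) unfolding unseparable_family_def by blast
  then show thesis using that[of X] by blast
qed

text \<open>If \<open>A\<close> has infinite trace on \<open>P\<close>, separation yields a set that meets exactly countably many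
  traces infinitely often; a countable family is not maximal, so we can diagonalise.\<close>

lemma orthog_subset:
  assumes A: "ad A" "small A" and P: "\<And>T. finite T \<Longrightarrow> T \<subseteq> A \<Longrightarrow> infinite (P - \<Union>T)"
  obtains Y where "Y \<subseteq> P" "infinite Y" "orthog Y A"
proof (cases "finite {a\<in>A. infinite (a \<inter> P)}")
  case True
  let ?Y = "P - \<Union>{a\<in>A. infinite (a \<inter> P)}"
  have "infinite ?Y" using P True by blast
  moreover have "finite (?Y \<inter> a)" if "a \<in> A" for a
  proof (cases "infinite (a \<inter> P)")
    case True
    then have "?Y \<inter> a = {}" using that by blast
    then show ?thesis by simp
  next
    case False
    then have "finite (a \<inter> P)" by simp
    then show ?thesis by (rule finite_subset[rotated]) auto
  qed
  ultimately show ?thesis using that unfolding orthog_def by blast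
next
  case False
  then obtain b :: "nat \<Rightarrow> nat set" where b: "inj b" "range b \<subseteq> {a\<in>A. infinite (a \<inter> P)}"
    using infinite_countable_subset by blast
  let ?tr = "\<lambda>a. a \<inter> P"
  define A' where "A' = {a\<in>A. infinite (a \<inter> P)}"
  have meet: "finite (a \<inter> P \<inter> (a' \<inter> P))" if "a \<in> A'" "a' \<in> A'" "a \<noteq> a'" for a a'
  proof -
    have "finite (a \<inter> a')" using that A by (auto simp: ad_def A'_def)
    then show ?thesis by (rule finite_subset[rotated]) auto
  qed
  have "ad (?tr ` A')" unfolding ad_def
  proof (intro conjI ballI impI)
    show "infinite x" if "x \<in> ?tr ` A'" for x using that by (auto simp: A'_def)
    show "finite (x \<inter> y)" if "x \<in> ?tr ` A'" "y \<in> ?tr ` A'" "x \<noteq> y" for x y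
      using that meet by blast
  qed
  moreover have "small (?tr ` A')"
    using A by (intro small_image small_subset[of A' A]) (auto simp: A'_def)
  moreover have "?tr ` range b \<subseteq> ?tr ` A'" using b by (auto simp: A'_def)
  ultimately obtain X where
    X0: "\<And>x. x \<in> ?tr ` A' - ?tr ` range b \<Longrightarrow> finite (X \<inter> x)" and
    X1: "\<And>x. x \<in> ?tr ` range b \<Longrightarrow> infinite (X \<inter> x)"
    using separation by metis
  \<comment> \<open>Equal infinite traces would be an infinite common part. Thus what
    \<open>X\<close> does to traces outside the chosen countable family carries over to the members
    of \<open>A'\<close>.\<close>
  have tr_inj: "a = a'" if "a \<in> A'" "a' \<in> A'" "?tr a = ?tr a'" for a a'
    using meet[OF that(1,2)] that by (auto simp: A'_def)
  \<comment> \<open>The \<open>i\<close>-th point avoids all earlier \<open>b j\<close>, so only the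
    points with index at most \<open>j\<close> can lie in \<open>b j\<close>;
    \<open>i \<le> y i\<close> makes the range infinite.\<close>
  have "\<exists>y. y \<in> X \<inter> P \<inter> b i - (\<Union>j<i. b j) \<and> i \<le> y" for i
  proof -
    have "finite (b i \<inter> \<Union>(b ` {..<i}))"
    proof (intro finite_inter_Union)
      fix a assume "a \<in> b ` {..<i}"
      then obtain j where "j < i" "a = b j" by auto
      moreover from this have "b i \<noteq> b j" using b(1) by (metis injD less_irrefl)
      ultimately show "finite (b i \<inter> a)" using b(2) by (intro ad_finite[OF A(1)]) auto
    qed simp
    moreover have "infinite (X \<inter> (b i \<inter> P))" using X1 by blast
    moreover have "X \<inter> (b i \<inter> P) \<subseteq> (X \<inter> P \<inter> b i - (\<Union>j<i. b j)) \<union> (b i \<inter> \<Union>(b ` {..<i}))" by auto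
    ultimately have "infinite (X \<inter> P \<inter> b i - (\<Union>j<i. b j))"
      by (meson finite_Un finite_subset)
    then show ?thesis by (meson infinite_nat_iff_unbounded_le)
  qed
  then obtain y where y: "\<And>i. y i \<in> X \<inter> P \<inter> b i - (\<Union>j<i. b j)" "\<And>i. i \<le> y i" by metis
  show ?thesis
  proof
    show "range y \<subseteq> P" using y by auto
    show "infinite (range y)"
      unfolding infinite_nat_iff_unbounded_le using y(2) by blast
    show "orthog (range y) A" unfolding orthog_def
    proof
      fix a assume a: "a \<in> A"
      consider "a \<notin> A'" | j where "a = b j" | "a \<in> A'" "a \<notin> range b" by blast
      then show "finite (range y \<inter> a)"
      proof cases
        case 1
        then have "finite (a \<inter> P)" using a by (auto simp: A'_def)
        then show ?thesis by (rule finite_subset[rotated]) (use y in auto)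
      next
        case (2 j)
        have "range y \<inter> b j \<subseteq> y ` {..j}"
        proof
          fix x assume x: "x \<in> range y \<inter> b j"
          then obtain i where i: "x = y i" by blast
          then have "\<not> j < i" using x y(1)[of i] by blast
          then show "x \<in> y ` {..j}" using i by auto
        qed
        then show ?thesis using 2 finite_subset by blast
      next
        case 3
        then have "?tr a \<notin> ?tr ` range b" using tr_inj[OF 3(1)] 3(2) b(2) unfolding A'_def by blast
        then have "finite (X \<inter> (a \<inter> P))" using X0 3 by blast
        then show ?thesis by (rule finite_subset[rotated]) (use y in auto)
      qed
    qed
  qed
qed

text \<open>If no set orthogonal to \<open>A\<close> is positive, a disjoint refinement of \<open>q\<close> orthogonal to \<open>A\<close> can be
  chosen by recursion, because each earlier choice is avoided by some member of \<open>q\<close>.\<close>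

lemma positive_orthog:
  assumes A: "ad A" "small A" and q: "small q" "\<And>P Q. P \<in> q \<Longrightarrow> Q \<in> q \<Longrightarrow> P \<inter> Q \<in> q"
    and pos: "\<And>Q T. Q \<in> q \<Longrightarrow> finite T \<Longrightarrow> T \<subseteq> A \<Longrightarrow> infinite (Q - \<Union>T)"
  obtains X where "orthog X A" "\<And>Q. Q \<in> q \<Longrightarrow> infinite (X \<inter> Q)"
proof (rule ccontr)
  assume "\<not> thesis"
  with that have no: "\<exists>Q\<in>q. finite (X \<inter> Q)" if "orthog X A" for X using that by blast
  \<comment> \<open>The members of \<open>q\<close> are subsets of \<omega> and serve as their own
    indices in \<open>below\<close>; outside \<open>q\<close> the value is arbitrary.\<close>
  define R where "R f x r \<longleftrightarrow> (x \<in> q \<longrightarrow> r \<subseteq> x \<and> infinite r \<and> orthog r A \<and>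
      (\<forall>y\<in>q. (y, x) \<in> below \<longrightarrow> finite (r \<inter> f y)))" for f :: "nat set \<Rightarrow> nat set" and x r
  have R_earlier: "finite (f x \<inter> f y)" if "R f x (f x)" "x \<in> q" "y \<in> q" "(y, x) \<in> below" for f x y
    using that unfolding R_def by blast
  have "\<exists>f. \<forall>x. R f x (f x)"
  proof (rule dependent_wf_choice[OF wf_below])
    show "R f x r = R g x r" if "\<And>z. (z, x) \<in> below \<Longrightarrow> f z = g z" for f g x r
      using that by (auto simp: R_def)
    show "\<exists>r. R f x r" if IH: "\<And>y. (y, x) \<in> below \<Longrightarrow> R f y (f y)" for x f
    proof (cases "x \<in> q")
      case True
      define Z where "Z = {y\<in>q. (y, x) \<in> below}"
      have Z: "R f y (f y)" "y \<in> q" if "y \<in> Z" for y using that IH by (auto simp: Z_def)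
      have fin_AZ: "finite (f y \<inter> a)" if "y \<in> Z" "a \<in> A" for y a
        using Z[OF that(1)] that by (auto simp: R_def orthog_def)
      have fin_ZZ: "finite (f y \<inter> f z)" if "y \<in> Z" "z \<in> Z" "y \<noteq> z" for y z
      proof -
        have "finite (f y \<inter> f z) \<or> finite (f z \<inter> f y)"
          using R_earlier Z that below_total[of y z] by metis
        then show ?thesis by (simp add: Int_commute)
      qed
      have "ad (A \<union> f ` Z)" unfolding ad_def
      proof (intro conjI ballI impI)
        show "infinite a" if "a \<in> A \<union> f ` Z" for a
          using that A Z by (auto simp: ad_def R_def)
        show "finite (a \<inter> b)" if "a \<in> A \<union> f ` Z" "b \<in> A \<union> f ` Z" "a \<noteq> b" for a b
          using that A fin_AZ fin_ZZ by (auto simp: ad_def Int_commute)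
      qed
      moreover have "small (A \<union> f ` Z)"
        using A q by (intro small_Un small_image small_subset[of Z q]) (auto simp: Z_def)
      moreover have "infinite (x - \<Union>T)" if T: "finite T" "T \<subseteq> A \<union> f ` Z" for T
      proof -
        \<comment> \<open>Intersecting \<open>x\<close> with one member of \<open>q\<close> for each
          earlier choice in \<open>S\<close> leaves a member of \<open>q\<close> almost disjoint
          from all of them; the part of \<open>T\<close> in \<open>A\<close> is then handled by
          \<open>pos\<close>.\<close>
        have "\<exists>Q\<in>q. Q \<subseteq> x \<and> finite (Q \<inter> \<Union>S)" if "finite S" "S \<subseteq> f ` Z" for S
          using that
        proof (induction S)
          case empty
          then show ?case using True by (intro bexI[of _ x]) auto
        next
          case (insert a S)
          then obtain Q where Q: "Q \<in> q" "Q \<subseteq> x" "finite (Q \<inter> \<Union>S)" by auto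
          obtain y where "y \<in> Z" "a = f y" using insert by auto
          then have "orthog a A" using Z by (auto simp: R_def)
          then obtain Q' where Q': "Q' \<in> q" "finite (a \<inter> Q')" using no by blast
          have "Q \<inter> Q' \<inter> \<Union>(insert a S) \<subseteq> (Q \<inter> \<Union>S) \<union> (a \<inter> Q')" by auto
          then have "finite (Q \<inter> Q' \<inter> \<Union>(insert a S))"
            using Q Q' by (meson finite_Un finite_subset)
          then show ?case using Q Q' q(2) by blast
        qed
        from this[of "T - A"] T obtain Q where Q: "Q \<in> q" "Q \<subseteq> x" "finite (Q \<inter> \<Union>(T - A))"
          by auto
        have "infinite (Q - \<Union>(T \<inter> A))" using pos Q(1) T by auto
        moreover have "Q - \<Union>(T \<inter> A) \<subseteq> (x - \<Union>T) \<union> (Q \<inter> \<Union>(T - A))" using Q by auto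
        ultimately show ?thesis using Q(3) by (meson finite_Un finite_subset)
      qed
      ultimately obtain Y where "Y \<subseteq> x" "infinite Y" "orthog Y (A \<union> f ` Z)"
        using orthog_subset by metis
      then have "R f x Y" by (auto simp: R_def orthog_def Z_def)
      then show ?thesis ..
    qed (simp add: R_def)
  qed
  then obtain f where f: "\<And>x. R f x (f x)" by blast
  have ff: "f x \<subseteq> x" "infinite (f x)" "orthog (f x) A" if "x \<in> q" for x
    using f[of x] that by (auto simp: R_def)
  have fin: "finite (f x \<inter> f y)" if "x \<in> q" "y \<in> q" "x \<noteq> y" for x y
    using R_earlier[OF f] below_total[of x y] that by (metis Int_commute)
  have "ad (A \<union> f ` q)" unfolding ad_def
  proof (intro conjI ballI impI)
    show "infinite a" if "a \<in> A \<union> f ` q" for a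
      using that A ff by (auto simp: ad_def)
    show "finite (a \<inter> b)" if "a \<in> A \<union> f ` q" "b \<in> A \<union> f ` q" "a \<noteq> b" for a b
      using that A fin ff by (auto simp: ad_def Int_commute orthog_def)
  qed
  moreover have "small (A \<union> f ` q)" using A q by (intro small_Un small_image)
  \<comment> \<open>Separating the refinement from \<open>A\<close> gives a set orthogonal to
    \<open>A\<close> that meets every \<open>f Q \<subseteq> Q\<close> infinitely, against
    \<open>no\<close>.\<close>
  ultimately obtain X where X: "\<And>a. a \<in> A \<union> f ` q - f ` q \<Longrightarrow> finite (X \<inter> a)"
    "\<And>a. a \<in> f ` q \<Longrightarrow> infinite (X \<inter> a)"
    using separation[of "A \<union> f ` q" "f ` q"] by auto
  have "orthog X A" unfolding orthog_def
  proof
    fix a assume a: "a \<in> A"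
    have "a \<notin> f ` q"
    proof
      assume "a \<in> f ` q"
      then obtain x where x: "x \<in> q" "a = f x" by blast
      then have "finite (f x \<inter> a)" using ff(3) a unfolding orthog_def by blast
      then show False using x ff(2) by auto
    qed
    then show "finite (X \<inter> a)" using X a by blast
  qed
  then obtain Q where Q: "Q \<in> q" "finite (X \<inter> Q)" using no by blast
  then have "finite (X \<inter> f Q)" using ff(1) by (meson Int_mono finite_subset order_refl)
  then show False using X Q by blast
qed

end


subsection \<open>The recursion\<close>

text \<open>Transfers a subset of \<omega> to the index set of \<open>C\<close>, where the filter
  base \<open>p C\<close> lives.\<close>

definition hits :: "(nat \<Rightarrow> nat set) \<Rightarrow> nat set \<Rightarrow> nat set" where
  "hits C a = {n. C n \<inter> a \<noteq> {}}"

text \<open>Empty terms are allowed, because the remainders of a converging sequence of finite sets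
  may be empty.\<close>

definition finite_disjoint_seq :: "(nat \<Rightarrow> nat set) \<Rightarrow> bool" where
  "finite_disjoint_seq C \<longleftrightarrow> (\<forall>n. finite (C n)) \<and> disjoint_family C"

text \<open>The strong finite intersection property: \<open>p\<close> and the cofinite sets together
  generate a proper filter.\<close>

definition sfip :: "nat set set \<Rightarrow> bool" where
  "sfip p \<longleftrightarrow> (\<forall>T. finite T \<longrightarrow> T \<subseteq> p \<longrightarrow> infinite (\<Inter>T))"

lemma sfipD: "sfip p \<Longrightarrow> finite T \<Longrightarrow> T \<subseteq> p \<Longrightarrow> infinite (\<Inter>T)"
  by (simp add: sfip_def)

lemma sfip_insertI:
  assumes "\<And>T. finite T \<Longrightarrow> T \<subseteq> p \<Longrightarrow> infinite (D \<inter> \<Inter>T)"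
  shows "sfip (insert D p)"
  unfolding sfip_def
proof (intro allI impI)
  fix T assume "finite T" "T \<subseteq> insert D p"
  then have "infinite (D \<inter> \<Inter>(T - {D}))" by (intro assms) auto
  moreover have "D \<inter> \<Inter>(T - {D}) \<subseteq> \<Inter>T" by auto
  ultimately show "infinite (\<Inter>T)" using finite_subset by blast
qed

text \<open>The ultrafilter step: if both extensions failed, the finitely many sets witnessing this
  would already have a finite intersection.\<close>

lemma sfip_insert_cases:
  assumes "sfip p"
  shows "sfip (insert D p) \<or> sfip (insert (- D) p)"
proof (rule ccontr)
  assume "\<not> ?thesis"
  then obtain S T where S: "finite S" "S \<subseteq> p" "finite (D \<inter> \<Inter>S)"
    and T: "finite T" "T \<subseteq> p" "finite (- D \<inter> \<Inter>T)"
    using sfip_insertI by metis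
  have "\<Inter>(S \<union> T) \<subseteq> (D \<inter> \<Inter>S) \<union> (- D \<inter> \<Inter>T)" by auto
  then have "finite (\<Inter>(S \<union> T))" using S T by (meson finite_UnI finite_subset)
  moreover have "infinite (\<Inter>(S \<union> T))" using assms S T by (intro sfipD) auto
  ultimately show False by blast
qed

text \<open>Points chosen from different terms are distinct by disjointness. Together with
  \<open>infinite_hits\<close> this translates between largeness on the index set and on
  \<omega>.\<close>

lemma infinite_inter_UN:
  assumes "finite_disjoint_seq C" "infinite N" "N \<subseteq> hits C Y"
  shows "infinite (Y \<inter> (\<Union>n\<in>N. C n))"
proof -
  have "\<forall>n\<in>N. \<exists>x. x \<in> C n \<inter> Y" using assms(3) by (auto simp: hits_def)
  then obtain g where g: "\<And>n. n \<in> N \<Longrightarrow> g n \<in> C n \<inter> Y" by metis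
  have "inj_on g N"
  proof (rule inj_onI)
    fix m n assume mn: "m \<in> N" "n \<in> N" "g m = g n"
    then have "C m \<inter> C n \<noteq> {}" using g[of m] g[of n] by auto
    then show "m = n" using assms(1) by (auto simp: finite_disjoint_seq_def disjoint_family_on_def)
  qed
  then have "infinite (g ` N)" using assms(2) finite_imageD by blast
  moreover have "g ` N \<subseteq> Y \<inter> (\<Union>n\<in>N. C n)" using g by auto
  ultimately show ?thesis using finite_subset by blast
qed

lemma infinite_hits:
  assumes "finite_disjoint_seq C" "infinite (X \<inter> (\<Union>n\<in>N. C n))"
  shows "infinite (hits C X \<inter> N)"
proof
  assume "finite (hits C X \<inter> N)"
  then have "finite (\<Union>n\<in>hits C X \<inter> N. C n)" using assms(1) by (auto simp: finite_disjoint_seq_def)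
  moreover have "X \<inter> (\<Union>n\<in>N. C n) \<subseteq> (\<Union>n\<in>hits C X \<inter> N. C n)" by (auto simp: hits_def)
  ultimately show False using assms(2) finite_subset by blast
qed

section \<open>A single step of the recursion\<close>

lemma infinite_halves:
  assumes "infinite (X :: nat set)"
  obtains X1 X2 where "X = X1 \<union> X2" "X1 \<inter> X2 = {}" "infinite X1" "infinite X2"
proof -
  obtain e :: "nat \<Rightarrow> nat" where e: "inj e" "range e = X"
    using assms strict_mono_enumerate strict_mono_imp_inj_on range_enumerate by metis
  let ?X1 = "range (\<lambda>n. e (2 * n))" and ?X2 = "range (\<lambda>n. e (2 * n + 1))"
  have "inj (\<lambda>n. e (2 * n))" "inj (\<lambda>n. e (2 * n + 1))"
    by (rule injI, drule injD[OF e(1)], simp)+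
  then have "infinite ?X1" "infinite ?X2" by (auto simp only: range_inj_infinite)
  moreover have "X = ?X1 \<union> ?X2"
  proof
    show "X \<subseteq> ?X1 \<union> ?X2"
    proof
      fix x assume "x \<in> X"
      then obtain n where n: "x = e n" using e(2) by blast
      obtain k where "n = 2 * k \<or> n = 2 * k + 1" by (metis evenE oddE)
      then show "x \<in> ?X1 \<union> ?X2" using n by blast
    qed
    show "?X1 \<union> ?X2 \<subseteq> X" using e(2) by auto
  qed
  moreover have "?X1 \<inter> ?X2 = {}"
  proof -
    have "e (2 * m) \<noteq> e (2 * n + 1)" for m n
    proof
      assume "e (2 * m) = e (2 * n + 1)"
      then have "2 * m = 2 * n + 1" by (rule injD[OF e(1)])
      then show False by presburger
    qed
    then show ?thesis by auto
  qed
  ultimately show ?thesis using that by blast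
qed

text \<open>The second conjunct survives the addition of a new set because only one half of it is added;
  it makes the final family infinite.\<close>

definition good :: "nat set set \<Rightarrow> ((nat \<Rightarrow> nat set) \<Rightarrow> nat set set) \<Rightarrow> bool" where
  "good A p \<longleftrightarrow> ad A \<and> (\<forall>T. finite T \<longrightarrow> T \<subseteq> A \<longrightarrow> infinite (- \<Union>T)) \<and>
     (\<forall>C. sfip (p C)) \<and> (\<forall>C. \<forall>a\<in>A. hits C a \<in> p C \<or> - hits C a \<in> p C)"

text \<open>The limit criterion for the single set \<open>Y\<close>: either \<open>C n\<close>
  misses \<open>Y\<close> along the filter, or \<open>Y\<close> accumulates at a member of the
  limit.\<close>

definition decided :: "nat set set \<Rightarrow> nat set set \<Rightarrow> (nat \<Rightarrow> nat set) \<Rightarrow> nat set \<Rightarrow> bool" where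
  "decided A P C Y \<longleftrightarrow> - hits C Y \<in> P \<or> (\<exists>a\<in>A. infinite (a \<inter> Y) \<and> hits C a \<in> P)"

text \<open>The reserve \<open>b\<close> is disjoint from \<open>a\<close> and orthogonal to
  \<open>A\<close>, so finitely many members leave almost all of it uncovered. Each
  \<open>p D\<close> takes a consistent side of \<open>hits D a\<close>, preferably the positive
  one, which is available for \<open>C\<close> by assumption.\<close>

lemma good_insert:
  assumes good: "good A p" and a: "infinite a" "orthog a A"
    and b: "infinite b" "orthog b A" "a \<inter> b = {}" and C: "sfip (insert (hits C a) (p C))"
  obtains p' where "\<And>D. finite (p' D)" "p' C = {hits C a}" "good (insert a A) (\<lambda>D. p D \<union> p' D)"
proof -
  define p' where "p' D = {if sfip (insert (hits D a) (p D)) then hits D a else - hits D a}" for D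
  have p': "sfip (p D \<union> p' D)" for D
    using sfip_insert_cases[of "p D" "hits D a"] good by (auto simp: p'_def good_def)
  have "good (insert a A) (\<lambda>D. p D \<union> p' D)"
    unfolding good_def
  proof (intro conjI allI impI ballI)
    show "sfip (p D \<union> p' D)" for D by (rule p')
    show "hits D c \<in> p D \<union> p' D \<or> - hits D c \<in> p D \<union> p' D" if "c \<in> insert a A" for D c
      using that good by (auto simp: p'_def good_def)
    show "ad (insert a A)"
      using good a by (auto simp: good_def ad_def orthog_def Int_commute)
    show "infinite (- \<Union>T)" if T: "finite T" "T \<subseteq> insert a A" for T
    proof (cases "a \<in> T")
      case True
      have "finite (b \<inter> \<Union>(T - {a}))"
        using T b by (intro finite_inter_Union) (auto simp: orthog_def)
      then have "infinite (b - b \<inter> \<Union>(T - {a}))" using b(1) by (rule Diff_infinite_finite)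
      moreover have "b - b \<inter> \<Union>(T - {a}) \<subseteq> - \<Union>T" using b(3) by auto
      ultimately show ?thesis using finite_subset by blast
    next
      case False
      then have "T \<subseteq> A" using T by blast
      then show ?thesis using good T by (simp add: good_def)
    qed
  qed
  moreover have "p' C = {hits C a}" using C by (simp add: p'_def)
  moreover have "finite (p' D)" for D by (simp add: p'_def)
  ultimately show ?thesis using that by blast
qed

context ap_eq_continuum
begin

text \<open>If \<open>p C\<close> can be made to avoid \<open>Y\<close>, this is done; if a member
  of the limit already meets \<open>Y\<close> infinitely, nothing is done. Otherwise the filter
  induced on \<omega> is positive with respect to \<open>A\<close>, and
  \<open>positive_orthog\<close> supplies a new member inside \<open>Y\<close>.\<close>

lemma good_extend:
  assumes good: "good A p" and small: "small A" "\<And>D. small (p D)" and C: "finite_disjoint_seq C"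
  obtains A' p' where "finite A'" "\<And>D. finite (p' D)" "good (A \<union> A') (\<lambda>D. p D \<union> p' D)"
    "decided (A \<union> A') (p C \<union> p' C) C Y"
proof -
  consider (miss) "sfip (insert (- hits C Y) (p C))"
    | (hit) "\<exists>a\<in>A. infinite (a \<inter> Y) \<and> hits C a \<in> p C"
    | (new) "\<not> sfip (insert (- hits C Y) (p C))" "\<And>a. a \<in> A \<Longrightarrow> infinite (a \<inter> Y) \<Longrightarrow> hits C a \<notin> p C"
    by blast
  then show ?thesis
  proof cases
    case miss
    let ?p' = "\<lambda>D. if D = C then {- hits C Y} else {}"
    have "good (A \<union> {}) (\<lambda>D. p D \<union> ?p' D)"
      using good miss by (auto simp: good_def)
    moreover have "decided (A \<union> {}) (p C \<union> ?p' C) C Y" by (simp add: decided_def)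
    ultimately show ?thesis by (intro that[of "{}" ?p']) auto
  next
    case hit
    then show ?thesis using good by (intro that[of "{}" "\<lambda>_. {}"]) (auto simp: decided_def)
  next
    case new
    have ad: "ad A" using good by (simp add: good_def)
    \<comment> \<open>Almost every index in \<open>\<Inter>T0\<close> belongs to a term that meets
      \<open>Y\<close>: the filter generated by \<open>p C\<close> contains
      \<open>hits C Y\<close>.\<close>
    obtain T0 where T0: "finite T0" "T0 \<subseteq> p C" "finite (- hits C Y \<inter> \<Inter>T0)"
      using new(1) sfip_insertI by blast
    \<comment> \<open>The filter induced on \<omega>, restricted to \<open>Y\<close>. Since each
      point lies in at most one term, \<open>Q\<close> turns unions into intersections.\<close>
    define Q where "Q T = Y \<inter> (\<Union>n\<in>\<Inter>T. C n)" for T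
    have Q_Int: "Q (S \<union> T) = Q S \<inter> Q T" for S T
    proof -
      have "m = n" if "x \<in> C m" "x \<in> C n" for x m n
        using C that by (auto simp: finite_disjoint_seq_def disjoint_family_on_def)
      then have "Q S \<inter> Q T \<subseteq> Q (S \<union> T)" unfolding Q_def by blast
      moreover have "Q (S \<union> T) \<subseteq> Q S \<inter> Q T" unfolding Q_def by blast
      ultimately show ?thesis by blast
    qed
    have Q_pos: "infinite (Q S - \<Union>T)" if S: "S \<in> Fpow (p C)" and T: "finite T" "T \<subseteq> A" for S T
    proof -
      \<comment> \<open>Members of \<open>T\<close> meeting \<open>Y\<close> in a finite set remove
        only finitely many points. For the others \<open>new(2)\<close> excludes the positive side,
        so \<open>p C\<close> contains \<open>- hits C a\<close>, and terms with such indices avoid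
        \<open>a\<close>.\<close>
      define T1 where "T1 = {a\<in>T. infinite (a \<inter> Y)}"
      let ?S = "S \<union> T0 \<union> (\<lambda>a. - hits C a) ` T1"
      have "- hits C a \<in> p C" if "a \<in> T1" for a
      proof -
        have "a \<in> A" "infinite (a \<inter> Y)" using that T by (auto simp: T1_def)
        then show ?thesis using new(2)[of a] good unfolding good_def by blast
      qed
      then have "?S \<subseteq> p C" using S T0 by (auto simp: Fpow_def)
      moreover have "finite ?S" using S T T0 by (simp add: T1_def Fpow_def)
      moreover have "sfip (p C)" using good by (simp add: good_def)
      ultimately have "infinite (\<Inter>?S)" by (intro sfipD)
      moreover have "\<Inter>?S \<subseteq> (\<Inter>?S \<inter> hits C Y) \<union> (- hits C Y \<inter> \<Inter>T0)" by auto
      ultimately have "infinite (\<Inter>?S \<inter> hits C Y)"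
        using T0(3) by (meson finite_UnI finite_subset)
      then have "infinite (Y \<inter> (\<Union>n\<in>\<Inter>?S \<inter> hits C Y. C n))" (is "infinite ?Z")
        using C by (intro infinite_inter_UN) auto
      moreover have "finite (Y \<inter> \<Union>(T - T1))"
        using T by (intro finite_inter_Union) (auto simp: T1_def Int_commute)
      ultimately have "infinite (?Z - Y \<inter> \<Union>(T - T1))" by (intro Diff_infinite_finite)
      moreover have "?Z - Y \<inter> \<Union>(T - T1) \<subseteq> Q S - \<Union>T"
      proof
        fix x assume x: "x \<in> ?Z - Y \<inter> \<Union>(T - T1)"
        then obtain n where n: "n \<in> \<Inter>?S" "x \<in> C n" "x \<in> Y" by blast
        have "x \<notin> a" if "a \<in> T" for a
        proof (cases "a \<in> T1")
          case True
          then have "n \<notin> hits C a" using n(1) by blast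
          then show ?thesis using n(2) by (auto simp: hits_def)
        next
          case False
          then show ?thesis using x that by blast
        qed
        moreover have "x \<in> Q S" using n by (auto simp: Q_def)
        ultimately show "x \<in> Q S - \<Union>T" by blast
      qed
      ultimately show ?thesis using finite_subset by blast
    qed
    have "small (Q ` Fpow (p C))" using small(2) by (intro small_image small_Fpow)
    moreover have "P \<inter> R \<in> Q ` Fpow (p C)" if "P \<in> Q ` Fpow (p C)" "R \<in> Q ` Fpow (p C)" for P R
    proof -
      obtain S T where ST: "S \<in> Fpow (p C)" "T \<in> Fpow (p C)" "P = Q S" "R = Q T" using \<open>P \<in> _\<close> \<open>R \<in> _\<close> by blast
      then have "S \<union> T \<in> Fpow (p C)" by (simp add: Fpow_def)
      then show ?thesis using Q_Int ST by blast
    qed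
    moreover have "infinite (P - \<Union>T)" if "P \<in> Q ` Fpow (p C)" "finite T" "T \<subseteq> A" for P T
      using Q_pos that by blast
    ultimately obtain X where X: "orthog X A" "\<And>P. P \<in> Q ` Fpow (p C) \<Longrightarrow> infinite (X \<inter> P)"
      using positive_orthog[OF ad small(1)] by metis
    have XQ: "infinite (X \<inter> Q T)" if "finite T" "T \<subseteq> p C" for T
      using X(2) that by (simp add: Fpow_def)
    then have "infinite (X \<inter> Q {})" by simp
    then have "infinite (X \<inter> Y)"
      by (rule contrapos_nn) (erule finite_subset[rotated], auto simp: Q_def)
    then obtain X1 X2 where X12: "X \<inter> Y = X1 \<union> X2" "X1 \<inter> X2 = {}" "infinite X1" "infinite X2"
      by (rule infinite_halves)
    have sub: "orthog Z A" if "Z \<subseteq> X" for Z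
      using X(1) that unfolding orthog_def by (meson Int_mono finite_subset order_refl)
    have "orthog X1 A" "orthog X2 A" using X12(1) by (auto intro!: sub)
    \<comment> \<open>If the halves failed at \<open>S\<close> and \<open>T\<close>, then
      \<open>X\<close> would fail at \<open>S \<union> T\<close>. A half that does not fail joins
      \<open>A\<close>; the other becomes the reserve.\<close>
    have "(\<forall>T. finite T \<longrightarrow> T \<subseteq> p C \<longrightarrow> infinite (X1 \<inter> Q T)) \<or> (\<forall>T. finite T \<longrightarrow> T \<subseteq> p C \<longrightarrow> infinite (X2 \<inter> Q T))"
    proof (rule ccontr)
      assume "\<not> ?thesis"
      then obtain S T where ST: "finite S" "S \<subseteq> p C" "finite (X1 \<inter> Q S)"
        "finite T" "T \<subseteq> p C" "finite (X2 \<inter> Q T)" by blast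
      have "X \<inter> Q (S \<union> T) \<subseteq> (X1 \<inter> Q S) \<union> (X2 \<inter> Q T)"
        using X12(1) Q_Int[of S T] by (auto simp: Q_def)
      then have "finite (X \<inter> Q (S \<union> T))" using ST by (meson finite_UnI finite_subset)
      then show False using XQ[of "S \<union> T"] ST by blast
    qed
    then obtain a b where a: "infinite a" "orthog a A" "a \<subseteq> Y" and b: "infinite b" "orthog b A" "a \<inter> b = {}"
      and aQ: "\<And>T. finite T \<Longrightarrow> T \<subseteq> p C \<Longrightarrow> infinite (a \<inter> Q T)"
    proof (elim disjE)
      assume "\<forall>T. finite T \<longrightarrow> T \<subseteq> p C \<longrightarrow> infinite (X1 \<inter> Q T)"
      then show thesis using X12 \<open>orthog X1 A\<close> \<open>orthog X2 A\<close> by (intro that[of X1 X2]) auto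
    next
      assume "\<forall>T. finite T \<longrightarrow> T \<subseteq> p C \<longrightarrow> infinite (X2 \<inter> Q T)"
      then show thesis using X12 \<open>orthog X1 A\<close> \<open>orthog X2 A\<close> by (intro that[of X2 X1]) auto
    qed
    have "sfip (insert (hits C a) (p C))"
    proof (rule sfip_insertI)
      fix T assume T: "finite T" "T \<subseteq> p C"
      have "a \<inter> Q T \<subseteq> a \<inter> (\<Union>n\<in>\<Inter>T. C n)" by (auto simp: Q_def)
      then have "infinite (a \<inter> (\<Union>n\<in>\<Inter>T. C n))" using aQ[OF T] finite_subset by blast
      then show "infinite (hits C a \<inter> \<Inter>T)" by (rule infinite_hits[OF C])
    qed
    then obtain p' where p': "\<And>D. finite (p' D)" "p' C = {hits C a}"
        "good (insert a A) (\<lambda>D. p D \<union> p' D)"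
      using good_insert[OF good a(1,2) b] by blast
    have "a \<inter> Y = a" using a(3) by blast
    then have "decided (A \<union> {a}) (p C \<union> p' C) C Y" using p'(2) a(1) by (simp add: decided_def)
    moreover have "good (A \<union> {a}) (\<lambda>D. p D \<union> p' D)" using p'(3) by simp
    ultimately show ?thesis using p'(1) by (intro that[of "{a}" p']) auto
  qed
qed

end


section \<open>Unions of stages and the full recursion\<close>

lemma finite_subset_UN_directed:
  assumes "finite T" "T \<subseteq> (\<Union>i\<in>S. M i)" "S \<noteq> {}"
    and "\<And>i j. i \<in> S \<Longrightarrow> j \<in> S \<Longrightarrow> \<exists>k\<in>S. M i \<subseteq> M k \<and> M j \<subseteq> M k"
  obtains k where "k \<in> S" "T \<subseteq> M k"
proof -
  have "\<exists>k\<in>S. T \<subseteq> M k" using assms(1,2)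
  proof (induction T)
    case empty
    then show ?case using assms(3) by blast
  next
    case (insert x T)
    then obtain i j where ij: "i \<in> S" "T \<subseteq> M i" "j \<in> S" "x \<in> M j" by auto
    from assms(4)[OF ij(1,3)] obtain k where "k \<in> S" "M i \<subseteq> M k" "M j \<subseteq> M k" by blast
    then show ?case using ij by blast
  qed
  then show ?thesis using that by blast
qed

lemma good_empty: "good {} (\<lambda>_. {})"
  by (simp add: good_def ad_def sfip_def)

text \<open>Each clause of \<open>good\<close> concerns finitely many sets at a time, and these lie
  in one stage by directedness. The empty index set covers the start of the recursion.\<close>

lemma good_UN_directed:
  assumes good: "\<And>i. i \<in> S \<Longrightarrow> good (A i) (p i)"
    and dir: "\<And>i j. i \<in> S \<Longrightarrow> j \<in> S \<Longrightarrow>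
      \<exists>k\<in>S. A i \<subseteq> A k \<and> A j \<subseteq> A k \<and> (\<forall>C. p i C \<subseteq> p k C \<and> p j C \<subseteq> p k C)"
  shows "good (\<Union>i\<in>S. A i) (\<lambda>C. \<Union>i\<in>S. p i C)"
proof (cases "S = {}")
  case True
  then show ?thesis by (simp add: good_empty)
next
  case False
  have dirA: "\<exists>k\<in>S. A i \<subseteq> A k \<and> A j \<subseteq> A k" if "i \<in> S" "j \<in> S" for i j
    using dir[OF that] by blast
  have dirp: "\<exists>k\<in>S. p i C \<subseteq> p k C \<and> p j C \<subseteq> p k C" if "i \<in> S" "j \<in> S" for i j C
    using dir[OF that] by blast
  show ?thesis unfolding good_def
  proof (intro conjI allI impI ballI)
    show "ad (\<Union>i\<in>S. A i)" unfolding ad_def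
    proof (intro conjI ballI impI)
      show "infinite a" if "a \<in> (\<Union>i\<in>S. A i)" for a
        using that good by (auto simp: good_def ad_def)
      fix a b assume ab: "a \<in> (\<Union>i\<in>S. A i)" "b \<in> (\<Union>i\<in>S. A i)" "a \<noteq> b"
      have "finite {a, b}" "{a, b} \<subseteq> (\<Union>i\<in>S. A i)" using ab by auto
      then obtain k where k: "k \<in> S" "{a, b} \<subseteq> A k"
        using False dirA by (rule finite_subset_UN_directed)
      then have "ad (A k)" using good by (simp add: good_def)
      then show "finite (a \<inter> b)" using ab(3) k(2) by (intro ad_finite) auto
    qed
    show "infinite (- \<Union>T)" if T: "finite T" "T \<subseteq> (\<Union>i\<in>S. A i)" for T
    proof -
      obtain k where "k \<in> S" "T \<subseteq> A k"
        using T False dirA by (rule finite_subset_UN_directed)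
      then show ?thesis using good T(1) by (simp add: good_def)
    qed
    show "sfip (\<Union>i\<in>S. p i C)" for C unfolding sfip_def
    proof (intro allI impI)
      fix T assume T: "finite T" "T \<subseteq> (\<Union>i\<in>S. p i C)"
      obtain k where "k \<in> S" "T \<subseteq> p k C"
        using T False dirp by (rule finite_subset_UN_directed)
      then show "infinite (\<Inter>T)" using good T(1) by (simp add: good_def sfip_def)
    qed
    fix C a assume "a \<in> (\<Union>i\<in>S. A i)"
    then obtain i where i: "i \<in> S" "a \<in> A i" by blast
    then have "hits C a \<in> p i C \<or> - hits C a \<in> p i C" using good by (simp add: good_def)
    then show "hits C a \<in> (\<Union>i\<in>S. p i C) \<or> - hits C a \<in> (\<Union>i\<in>S. p i C)" using i(1) by blast
  qed
qed

lemma decided_mono: "decided A P C Y \<Longrightarrow> A \<subseteq> B \<Longrightarrow> P \<subseteq> Q \<Longrightarrow> decided B Q C Y"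
  unfolding decided_def by blast

text \<open>Subsets of \<open>\<omega>\<close> encode the tasks \<open>(C, Y)\<close> of the recursion.\<close>

definition decode_seq :: "nat set \<Rightarrow> nat \<Rightarrow> nat set" where
  "decode_seq Z n = {m. prod_encode (Suc n, m) \<in> Z}"

definition decode_set :: "nat set \<Rightarrow> nat set" where
  "decode_set Z = {m. prod_encode (0, m) \<in> Z}"

lemma decode_surj: "\<exists>Z. decode_seq Z = C \<and> decode_set Z = Y"
proof
  let ?Z = "{prod_encode (0, m) | m. m \<in> Y} \<union> {prod_encode (Suc n, m) | n m. m \<in> C n}"
  have "decode_seq ?Z n = C n" for n by (auto simp: decode_seq_def)
  then show "decode_seq ?Z = C \<and> decode_set ?Z = Y" by (auto simp: decode_set_def fun_eq_iff)
qed

context ap_eq_continuum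
begin

text \<open>Stage \<open>i\<close> treats the task coded by \<open>i\<close> and records only the
  finitely many sets it adds. Every task has a code, and \<open>decided\<close> persists when more
  is added.\<close>

theorem decided_family_exists:
  obtains A p where "good A p" "\<And>C Y. finite_disjoint_seq C \<Longrightarrow> decided A (p C) C Y"
proof -
  define AA where "AA f S = (\<Union>j\<in>S. fst (f j))"
    for f :: "nat set \<Rightarrow> nat set set \<times> ((nat \<Rightarrow> nat set) \<Rightarrow> nat set set)" and S
  define PP where "PP f S C = (\<Union>j\<in>S. snd (f j) C)"
    for f :: "nat set \<Rightarrow> nat set set \<times> ((nat \<Rightarrow> nat set) \<Rightarrow> nat set set)" and S C
  define B where "B i = {j. (j, i) \<in> below}" for i
  \<comment> \<open>Goodness of what precedes is only a premise here; \<open>good_C\<close>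
    establishes it afterwards by induction. Finiteness is unconditional, so that the preceding sets
    are small in any case.\<close>
  define R where "R f i r \<longleftrightarrow> finite (fst r) \<and> (\<forall>C. finite (snd r C)) \<and>
      (good (AA f (B i)) (PP f (B i)) \<longrightarrow>
        good (AA f (B i) \<union> fst r) (\<lambda>C. PP f (B i) C \<union> snd r C) \<and>
        (finite_disjoint_seq (decode_seq i) \<longrightarrow>
          decided (AA f (B i) \<union> fst r) (PP f (B i) (decode_seq i) \<union> snd r (decode_seq i))
            (decode_seq i) (decode_set i)))" for f i r
  have "\<exists>f. \<forall>i. R f i (f i)"
  proof (rule dependent_wf_choice[OF wf_below])
    fix f g :: "nat set \<Rightarrow> nat set set \<times> ((nat \<Rightarrow> nat set) \<Rightarrow> nat set set)" and i r
    assume "\<And>z. (z, i) \<in> below \<Longrightarrow> f z = g z"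
    then have "AA f (B i) = AA g (B i)" "PP f (B i) = PP g (B i)"
      by (auto simp: AA_def PP_def B_def fun_eq_iff)
    then show "R f i r = R g i r" unfolding R_def by simp
  next
    fix i f assume IH: "\<And>j. (j, i) \<in> below \<Longrightarrow> R f j (f j)"
    have sm: "small (AA f (B i))" "small (PP f (B i) C)" for C
      unfolding AA_def PP_def
      using IH small_below[of i] by (auto intro!: small_UN_finite simp: R_def B_def)
    show "\<exists>r. R f i r"
    proof (cases "good (AA f (B i)) (PP f (B i)) \<and> finite_disjoint_seq (decode_seq i)")
      case True
      then have T: "good (AA f (B i)) (PP f (B i))" "finite_disjoint_seq (decode_seq i)" by auto
      obtain A' p' where "finite A'" "\<And>D. finite (p' D)"
        "good (AA f (B i) \<union> A') (\<lambda>D. PP f (B i) D \<union> p' D)"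
        "decided (AA f (B i) \<union> A') (PP f (B i) (decode_seq i) \<union> p' (decode_seq i))
           (decode_seq i) (decode_set i)"
        by (rule good_extend[OF T(1) sm T(2), where Y = "decode_set i"]) (rule that)
      then have "R f i (A', p')" by (simp add: R_def)
      then show ?thesis ..
    next
      case False
      then have "R f i ({}, \<lambda>_. {})" by (auto simp: R_def)
      then show ?thesis ..
    qed
  qed
  then obtain f where f: "\<And>i. R f i (f i)" by blast
  \<comment> \<open>Closed initial segments. Each open segment \<open>B i\<close> is the union of
    the closed ones below it, so successor and limit stages are treated alike.\<close>
  define C where "C i = insert i (B i)" for i
  have AA_C: "AA f (C i) = AA f (B i) \<union> fst (f i)" and PP_C: "PP f (C i) = (\<lambda>D. PP f (B i) D \<union> snd (f i) D)" for i
    by (auto simp: AA_def PP_def C_def fun_eq_iff)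
  have C_chain: "C i \<subseteq> C j \<or> C j \<subseteq> C i" for i j
    using below_total[of i j] below_trans by (auto simp: C_def B_def)
  have mono: "AA f S \<subseteq> AA f T" "PP f S D \<subseteq> PP f T D" if "S \<subseteq> T" for S T D
    using that by (auto simp: AA_def PP_def)
  have good_UN: "good (AA f (\<Union>i\<in>S. C i)) (PP f (\<Union>i\<in>S. C i))"
    if "\<And>i. i \<in> S \<Longrightarrow> good (AA f (C i)) (PP f (C i))" for S
  proof -
    have "good (\<Union>i\<in>S. AA f (C i)) (\<lambda>D. \<Union>i\<in>S. PP f (C i) D)"
    proof (rule good_UN_directed)
      fix i j assume ij: "i \<in> S" "j \<in> S"
      show "\<exists>k\<in>S. AA f (C i) \<subseteq> AA f (C k) \<and> AA f (C j) \<subseteq> AA f (C k) \<and>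
          (\<forall>D. PP f (C i) D \<subseteq> PP f (C k) D \<and> PP f (C j) D \<subseteq> PP f (C k) D)"
        using C_chain[of i j]
      proof
        assume "C i \<subseteq> C j"
        then show ?thesis using ij mono by (intro bexI[of _ j]) auto
      next
        assume "C j \<subseteq> C i"
        then show ?thesis using ij mono by (intro bexI[of _ i]) auto
      qed
    qed (rule that)
    then show ?thesis by (simp add: AA_def PP_def[abs_def])
  qed
  have good_C: "good (AA f (C i)) (PP f (C i))" for i
    using wf_below
  proof (induction i rule: wf_induct_rule)
    case (less i)
    have "(\<Union>j\<in>B i. C j) = B i"
      using below_trans by (auto simp: C_def B_def)
    then have "good (AA f (B i)) (PP f (B i))"
      using good_UN[of "B i"] less by (simp add: B_def)
    then show ?case using f[of i] unfolding AA_C PP_C R_def by blast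
  qed
  have "(\<Union>i. C i) = UNIV" by (auto simp: C_def)
  then have good: "good (AA f UNIV) (PP f UNIV)" using good_UN[of UNIV] good_C by simp
  have "decided (AA f UNIV) (PP f UNIV D) D Y" if D: "finite_disjoint_seq D" for D Y
  proof -
    obtain i where i: "decode_seq i = D" "decode_set i = Y" using decode_surj by blast
    have "(\<Union>j\<in>B i. C j) = B i"
      using below_trans by (auto simp: C_def B_def)
    then have "good (AA f (B i)) (PP f (B i))"
      using good_UN[of "B i"] good_C by simp
    then have "decided (AA f (C i)) (PP f (C i) D) D Y"
      using f[of i] D i unfolding AA_C PP_C R_def by blast
    then show ?thesis using mono by (rule decided_mono) auto
  qed
  with good show ?thesis by (rule that)
qed

end


subsection \<open>The space and its hyperspace\<close>

text \<open>Points of \<omega> are isolated, and the basic neighbourhoods of \<open>Inr a\<close>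
  contain almost all of \<open>a\<close>; hence only the points of \<open>A\<close> in
  \<open>U\<close> impose a condition.\<close>

lemma openin_Psi_iff:
  "openin (Psi A) U \<longleftrightarrow> U \<subseteq> range Inl \<union> Inr ` A \<and>
     (\<forall>a\<in>A. Inr a \<in> U \<longrightarrow> finite {x \<in> a. Inl x \<notin> U})"
proof
  assume U: "openin (Psi A) U"
  have "finite {x \<in> a. Inl x \<notin> U}" if a: "Inr a \<in> U" for a
  proof -
    have "\<forall>x\<in>U. \<exists>V. V \<in> Psi_base A \<and> x \<in> V \<and> V \<subseteq> U"
      using U by (simp only: openin_Psi arbitrary_union_of_alt)
    then obtain V where "V \<in> Psi_base A" "Inr a \<in> V" "V \<subseteq> U"
      using bspec[OF _ a] by blast
    then obtain F where "finite F" "Inl ` (a - F) \<subseteq> U" by (auto simp: Psi_base_def)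
    then have "{x \<in> a. Inl x \<notin> U} \<subseteq> F" by blast
    then show ?thesis using \<open>finite F\<close> by (rule finite_subset)
  qed
  then show "U \<subseteq> range Inl \<union> Inr ` A \<and> (\<forall>a\<in>A. Inr a \<in> U \<longrightarrow> finite {x \<in> a. Inl x \<notin> U})"
    using openin_subset[OF U] by (auto simp: topspace_Psi)
next
  assume U: "U \<subseteq> range Inl \<union> Inr ` A \<and> (\<forall>a\<in>A. Inr a \<in> U \<longrightarrow> finite {x \<in> a. Inl x \<notin> U})"
  have "\<exists>V\<in>Psi_base A. x \<in> V \<and> V \<subseteq> U" if "x \<in> U" for x
  proof (cases x)
    case (Inl n)
    then show ?thesis using that by (intro bexI[of _ "{Inl n}"]) (auto simp: Psi_base_def)
  next
    case (Inr a)
    let ?F = "{x \<in> a. Inl x \<notin> U}"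
    have "a \<in> A" "finite ?F" using U that Inr by auto
    then have "{Inr a} \<union> Inl ` (a - ?F) \<in> Psi_base A" unfolding Psi_base_def by blast
    then show ?thesis using that Inr by (rule_tac bexI[of _ "{Inr a} \<union> Inl ` (a - ?F)"]) auto
  qed
  then show "openin (Psi A) U"
    unfolding openin_Psi arbitrary_union_of_alt Bex_def by (rule ballI)
qed

text \<open>A point \<open>a\<close> of \<open>A\<close> outside \<open>B\<close> meets
  \<open>R\<close> in a finite set, and removing that set from \<open>a\<close> gives a
  neighbourhood of the point disjoint from \<open>R\<close> and \<open>B\<close>.\<close>

lemma closedin_Psi:
  assumes "B \<subseteq> A" "\<And>a. a \<in> A \<Longrightarrow> infinite (a \<inter> R) \<Longrightarrow> a \<in> B"
  shows "closedin (Psi A) (Inl ` R \<union> Inr ` B)"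
  unfolding closedin_def openin_Psi_iff topspace_Psi
proof (intro conjI ballI impI)
  show "Inl ` R \<union> Inr ` B \<subseteq> range Inl \<union> Inr ` A" using assms(1) by auto
  show "range Inl \<union> Inr ` A - (Inl ` R \<union> Inr ` B) \<subseteq> range Inl \<union> Inr ` A" by auto
  fix a assume "a \<in> A" "Inr a \<in> range Inl \<union> Inr ` A - (Inl ` R \<union> Inr ` B)"
  then have "finite (a \<inter> R)" using assms(2) by auto
  then show "finite {x \<in> a. Inl x \<notin> range Inl \<union> Inr ` A - (Inl ` R \<union> Inr ` B)}"
    by (rule finite_subset[rotated]) auto
qed

lemma finite_in_hyperspace_Psi:
  assumes "finite G" "G \<noteq> {}"
  shows "Inl ` G \<in> hyperspace (Psi A)"
  using closedin_Psi[of "{}" A G] assms by (simp add: hyperspace_def)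

section \<open>Basic neighbourhoods in the hyperspace and density of the finite sets\<close>

text \<open>Finitely many upper conditions merge into a single \<open>U\<close> by intersection,
  while the lower ones are collected in \<open>\<V>\<close>.\<close>

lemma Vietoris_nhd:
  assumes "openin (Vietoris X) W" "E \<in> W"
  obtains U \<V> where "openin X U" "E \<subseteq> U" "finite \<V>" "\<And>V. V \<in> \<V> \<Longrightarrow> openin X V \<and> E \<inter> V \<noteq> {}"
    "\<And>E'. E' \<in> hyperspace X \<Longrightarrow> E' \<subseteq> U \<Longrightarrow> (\<And>V. V \<in> \<V> \<Longrightarrow> E' \<inter> V \<noteq> {}) \<Longrightarrow> E' \<in> W"
proof -
  let ?S = "{{F \<in> hyperspace X. F \<subseteq> U} | U. openin X U} \<union>
    {{F \<in> hyperspace X. F \<inter> U \<noteq> {}} | U. openin X U}"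
  have E: "E \<in> hyperspace X"
    using assms openin_subset topspace_Vietoris by blast
  define N where "N W U \<V> \<longleftrightarrow> openin X U \<and> E \<subseteq> U \<and> finite \<V> \<and> (\<forall>V\<in>\<V>. openin X V \<and> E \<inter> V \<noteq> {}) \<and>
    (\<forall>E'\<in>hyperspace X. E' \<subseteq> U \<and> (\<forall>V\<in>\<V>. E' \<inter> V \<noteq> {}) \<longrightarrow> E' \<in> W)" for W U \<V>
  have "generate_topology_on ?S W"
    using assms(1) unfolding Vietoris_def openin_topology_generated_by_iff .
  then have "E \<in> W \<longrightarrow> (\<exists>U \<V>. N W U \<V>)"
  proof induction
    case Empty
    then show ?case by simp
  next
    case (Int S T)
    show ?case
    proof
      assume "E \<in> S \<inter> T"
      then obtain U \<V> U' \<V>' where "N S U \<V>" "N T U' \<V>'" using Int.IH by blast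
      then have "N (S \<inter> T) (U \<inter> U') (\<V> \<union> \<V>')" unfolding N_def by (simp add: openin_Int ball_Un)
      then show "\<exists>U \<V>. N (S \<inter> T) U \<V>" by blast
    qed
  next
    case (UN K)
    show ?case
    proof
      assume "E \<in> \<Union>K"
      then obtain k where k: "k \<in> K" "E \<in> k" by blast
      then obtain U \<V> where "N k U \<V>" using UN.IH by blast
      then have "N (\<Union>K) U \<V>" using k(1) unfolding N_def by blast
      then show "\<exists>U \<V>. N (\<Union>K) U \<V>" by blast
    qed
  next
    case (Basis S)
    show ?case
    proof
      assume ES: "E \<in> S"
      from Basis consider U where "openin X U" "S = {F \<in> hyperspace X. F \<subseteq> U}"
        | U where "openin X U" "S = {F \<in> hyperspace X. F \<inter> U \<noteq> {}}" by blast
      then show "\<exists>U \<V>. N S U \<V>"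
      proof cases
        case (1 U)
        then have "N S U {}" using ES by (simp add: N_def)
        then show ?thesis by blast
      next
        case (2 U)
        have "E \<subseteq> topspace X" using E by (auto simp: hyperspace_def dest: closedin_subset)
        then have "N S (topspace X) {U}" using ES 2 by (simp add: N_def)
        then show ?thesis by blast
      qed
    qed
  qed
  then obtain U \<V> where "N W U \<V>" using assms(2) by blast
  then show ?thesis unfolding N_def by (intro that) auto
qed

text \<open>As the members of \<open>A\<close> are infinite, every nonempty open set of the space
  contains a point of \<omega>. One such point for each lower condition, all inside
  \<open>U\<close>, gives the finite set.\<close>

lemma finite_sets_dense:
  assumes A: "\<forall>a\<in>A. infinite a" and W: "openin (Vietoris (Psi A)) W" "W \<noteq> {}"
  obtains G where "finite G" "G \<noteq> {}" "Inl ` G \<in> W"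
proof -
  obtain E where E: "E \<in> W" using W(2) by blast
  then have hyp: "E \<in> hyperspace (Psi A)" using W(1) openin_subset topspace_Vietoris by blast
  obtain U \<V> where U: "openin (Psi A) U" "E \<subseteq> U" "finite \<V>"
    "\<And>V. V \<in> \<V> \<Longrightarrow> openin (Psi A) V \<and> E \<inter> V \<noteq> {}"
    "\<And>E'. E' \<in> hyperspace (Psi A) \<Longrightarrow> E' \<subseteq> U \<Longrightarrow> (\<And>V. V \<in> \<V> \<Longrightarrow> E' \<inter> V \<noteq> {}) \<Longrightarrow> E' \<in> W"
    by (rule Vietoris_nhd[OF W(1) E]) (rule that; blast)
  have nat_point: "\<exists>n. Inl n \<in> H" if H: "openin (Psi A) H" "H \<noteq> {}" for H
  proof -
    obtain x where x: "x \<in> H" using H(2) by blast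
    show ?thesis
    proof (cases x)
      case (Inr a)
      then have a: "a \<in> A" "finite {n \<in> a. Inl n \<notin> H}" using x H(1) by (auto simp: openin_Psi_iff)
      have "\<not> a \<subseteq> {n \<in> a. Inl n \<notin> H}" using finite_subset[OF _ a(2)] A a(1) by blast
      then show ?thesis by blast
    qed (use x in auto)
  qed
  \<comment> \<open>\<open>U\<close> is counted among the conditions so that the finite set is
    nonempty even if \<open>\<V>\<close> is empty.\<close>
  have "\<exists>n. Inl n \<in> U \<inter> V" if "V \<in> insert U \<V>" for V
  proof (rule nat_point)
    show "openin (Psi A) (U \<inter> V)" using U(1) U(4) that by auto
    show "U \<inter> V \<noteq> {}" using U(2) U(4) that hyp by (auto simp: hyperspace_def)
  qed
  then obtain g where g: "\<And>V. V \<in> insert U \<V> \<Longrightarrow> Inl (g V) \<in> U \<inter> V" by metis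
  let ?G = "g ` insert U \<V>"
  have "Inl ` ?G \<in> W"
  proof (rule U(5))
    show "Inl ` ?G \<in> hyperspace (Psi A)" using U(3) by (intro finite_in_hyperspace_Psi) auto
    show "Inl ` ?G \<subseteq> U" using g by blast
    show "Inl ` ?G \<inter> V \<noteq> {}" if "V \<in> \<V>" for V using g[of V] that by blast
  qed
  then show ?thesis using U(3) by (intro that[of ?G]) auto
qed

text \<open>Compactness of the Cantor space; the remainders \<open>G (m n) - {..<k n}\<close> are pairwise disjoint.\<close>

lemma finite_sets_subsequence:
  fixes G :: "nat \<Rightarrow> nat set"
  assumes fin: "\<And>n. finite (G n)"
  obtains R m k where "strict_mono (m :: nat \<Rightarrow> nat)" "strict_mono (k :: nat \<Rightarrow> nat)"
    "\<forall>n. G (m n) \<inter> {..<k n} = R \<inter> {..<k n}" "\<forall>n. G (m n) \<subseteq> {..<k (Suc n)}"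
proof -
  \<comment> \<open>A node \<open>s\<close> at level \<open>k\<close> of the binary tree is kept if
    infinitely many \<open>G m\<close> agree with it below \<open>k\<close>; a branch through such
    nodes gives \<open>R\<close>.\<close>
  define P where "P k s \<longleftrightarrow> s \<subseteq> {..<k} \<and> infinite {m. G m \<inter> {..<k} = s}" for k s
  have "\<exists>s. \<forall>k. P k (s k) \<and> s (Suc k) \<inter> {..<k} = s k"
  proof (rule dependent_nat_choice)
    show "\<exists>s. P 0 s" by (auto simp: P_def)
    fix s k assume s: "P k s"
    have "{m. G m \<inter> {..<k} = s} \<subseteq>
        {m. G m \<inter> {..<Suc k} = s} \<union> {m. G m \<inter> {..<Suc k} = insert k s}"
      by (auto simp: lessThan_Suc)
    then have "infinite {m. G m \<inter> {..<Suc k} = s} \<or> infinite {m. G m \<inter> {..<Suc k} = insert k s}"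
      using s unfolding P_def by (meson finite_UnI finite_subset)
    then show "\<exists>t. P (Suc k) t \<and> t \<inter> {..<k} = s"
    proof
      assume "infinite {m. G m \<inter> {..<Suc k} = s}"
      then show ?thesis using s by (intro exI[of _ s]) (auto simp: P_def)
    next
      assume "infinite {m. G m \<inter> {..<Suc k} = insert k s}"
      then show ?thesis using s by (intro exI[of _ "insert k s"]) (auto simp: P_def)
    qed
  qed
  then obtain s where s: "\<And>k. P k (s k)" "\<And>k. s (Suc k) \<inter> {..<k} = s k" by blast
  define R where "R = (\<Union>k. s k)"
  have s_le: "s j \<inter> {..<i} = s i" if "i \<le> j" for i j
    using that
  proof (induction j rule: dec_induct)
    case base
    then show ?case using s(1)[of i] by (auto simp: P_def)
  next
    case (step j)
    have "s (Suc j) \<inter> {..<i} = s (Suc j) \<inter> {..<j} \<inter> {..<i}"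
      using step.hyps(1) by auto
    then show ?case by (simp only: s(2) step.IH)
  qed
  have "R \<inter> {..<k} = s k" for k
  proof
    show "R \<inter> {..<k} \<subseteq> s k"
    proof
      fix x assume x: "x \<in> R \<inter> {..<k}"
      then obtain j where j: "x \<in> s j" by (auto simp: R_def)
      show "x \<in> s k"
      proof (cases "j \<le> k")
        case True
        then show ?thesis using s_le[OF True] j by blast
      next
        case False
        then show ?thesis using s_le[of k j] j x by auto
      qed
    qed
    show "s k \<subseteq> R \<inter> {..<k}" using s(1)[of k] by (auto simp: R_def P_def)
  qed
  then have inf: "infinite {m. G m \<inter> {..<k} = R \<inter> {..<k}}" for k
    using s(1)[of k] by (simp add: P_def)
  \<comment> \<open>Pairs of an index and a cut: the next cut lies beyond the whole current set, and
    the next index is chosen to agree with \<open>R\<close> below that cut. At the start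
    \<open>(0, 0)\<close> agreement is vacuous.\<close>
  have "\<exists>f. \<forall>n. G (fst (f n)) \<inter> {..<snd (f n)} = R \<inter> {..<snd (f n)} \<and>
      (fst (f n) < fst (f (Suc n)) \<and> snd (f n) < snd (f (Suc n)) \<and> G (fst (f n)) \<subseteq> {..<snd (f (Suc n))})"
  proof (rule dependent_nat_choice)
    show "\<exists>x. G (fst x) \<inter> {..<snd x} = R \<inter> {..<snd x}" by (intro exI[of _ "(0, 0)"]) simp
    fix x :: "nat \<times> nat"
    obtain b where b: "G (fst x) \<subseteq> {..<b}"
      using fin by (metis finite_nat_iff_bounded)
    let ?k = "max b (Suc (snd x))"
    obtain m where m: "m > fst x" "G m \<inter> {..<?k} = R \<inter> {..<?k}"
      using inf[of ?k] by (auto simp: infinite_nat_iff_unbounded)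
    show "\<exists>y. G (fst y) \<inter> {..<snd y} = R \<inter> {..<snd y} \<and>
        fst x < fst y \<and> snd x < snd y \<and> G (fst x) \<subseteq> {..<snd y}"
      using m b by (intro exI[of _ "(m, ?k)"]) auto
  qed
  then obtain f where f: "\<And>n. G (fst (f n)) \<inter> {..<snd (f n)} = R \<inter> {..<snd (f n)}"
    "\<And>n. fst (f n) < fst (f (Suc n))" "\<And>n. snd (f n) < snd (f (Suc n))"
    "\<And>n. G (fst (f n)) \<subseteq> {..<snd (f (Suc n))}" by blast
  show ?thesis
    by (rule that[of "\<lambda>n. fst (f n)" "\<lambda>n. snd (f n)" R]) (use f in \<open>auto simp: strict_mono_Suc_iff\<close>)
qed


section \<open>Limits along the filters and pseudocompactness\<close>

lemma sfip_unbounded: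
  assumes "sfip p" "finite T" "T \<subseteq> p"
  obtains n where "n \<in> \<Inter>T" "(N :: nat) \<le> n"
  using sfipD[OF assms] unfolding infinite_nat_iff_unbounded_le by blast

text \<open>The limit of a sequence of finite sets along the filter \<open>p F\<close> of its remainders is the closure
  of \<open>R\<close> together with all \<open>a \<in> A\<close> that are hit \<open>p F\<close>-often.\<close>

lemma pseudocompact_Vietoris_Psi:
  assumes good: "good A p" and dec: "\<And>C Y. finite_disjoint_seq C \<Longrightarrow> decided A (p C) C Y"
  shows "pseudocompact_space (Vietoris (Psi A))"
  unfolding pseudocompact_space_iff
proof (intro allI impI, rule ccontr)
  let ?V = "Vietoris (Psi A)"
  fix f assume f: "continuous_map ?V euclideanreal f"
    and unb: "\<not> (\<exists>M. \<forall>x\<in>topspace ?V. \<bar>f x\<bar> \<le> M)"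
  have ad: "ad A" using good by (simp add: good_def)
  have ad_inf: "\<forall>a\<in>A. infinite a" using ad by (simp add: ad_def)
  have "\<exists>G. finite G \<and> G \<noteq> {} \<and> \<bar>f (Inl ` G)\<bar> > real n" for n
  proof -
    have "open {x :: real. \<bar>x\<bar> > real n}" by (intro open_Collect_less continuous_intros)
    then have "openin ?V {E \<in> topspace ?V. f E \<in> {x. \<bar>x\<bar> > real n}}"
      by (rule openin_continuous_map_preimage[OF f, folded open_openin])
    moreover have "{E \<in> topspace ?V. f E \<in> {x. \<bar>x\<bar> > real n}} \<noteq> {}"
      using unb by (auto simp: not_le)
    ultimately obtain G where "finite G" "G \<noteq> {}" "Inl ` G \<in> {E \<in> topspace ?V. f E \<in> {x. \<bar>x\<bar> > real n}}"
      by (rule finite_sets_dense[OF ad_inf]) (rule that)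
    then show ?thesis by blast
  qed
  then obtain G where G: "\<And>n. finite (G n)" "\<And>n. G n \<noteq> {}" "\<And>n. \<bar>f (Inl ` G n)\<bar> > real n"
    by metis
  obtain R m k where m: "strict_mono (m :: nat \<Rightarrow> nat)" and k: "strict_mono (k :: nat \<Rightarrow> nat)"
    and "\<forall>n. G (m n) \<inter> {..<k n} = R \<inter> {..<k n}" "\<forall>n. G (m n) \<subseteq> {..<k (Suc n)}"
    by (rule finite_sets_subsequence[of G, OF G(1)]) (erule (3) that)
  then have GR: "G (m n) \<inter> {..<k n} = R \<inter> {..<k n}" and Gk: "G (m n) \<subseteq> {..<k (Suc n)}" for n
    by auto
  define F where "F n = G (m n) - {..<k n}" for n
  have F_lt: "F i \<inter> F j = {}" if "i < j" for i j
  proof -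
    have "k (Suc i) \<le> k j" using that k by (simp add: strict_mono_less_eq)
    then show ?thesis using Gk[of i] by (auto simp: F_def)
  qed
  have F: "finite_disjoint_seq F"
    unfolding finite_disjoint_seq_def disjoint_family_on_def
  proof (intro conjI allI ballI impI)
    show "finite (F n)" for n by (simp add: F_def G(1))
    show "F i \<inter> F j = {}" if "i \<noteq> j" for i j
      using F_lt[of i j] F_lt[of j i] that by (cases "i < j") (auto simp: Int_commute)
  qed
  have sfip: "sfip (p F)" using good by (simp add: good_def)
  define B where "B = {a \<in> A. infinite (a \<inter> R) \<or> hits F a \<in> p F}"
  define L where "L = Inl ` R \<union> Inr ` B"
  \<comment> \<open>Truth on a set of the filter generated by \<open>p F\<close> and the cofinite
    sets.\<close>
  define ev where "ev P \<longleftrightarrow> (\<exists>T N. finite T \<and> T \<subseteq> p F \<and> (\<forall>n\<in>\<Inter>T. N \<le> n \<longrightarrow> P n))" for P :: "nat \<Rightarrow> bool"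
  have ev_conj: "ev (\<lambda>n. P n \<and> Q n)" if PQ: "ev P" "ev Q" for P Q
  proof -
    obtain S M T N where "finite S" "S \<subseteq> p F" "\<forall>n\<in>\<Inter>S. M \<le> n \<longrightarrow> P n"
      "finite T" "T \<subseteq> p F" "\<forall>n\<in>\<Inter>T. N \<le> n \<longrightarrow> Q n" using PQ unfolding ev_def by blast
    then show ?thesis unfolding ev_def by (intro exI[of _ "S \<union> T"] exI[of _ "max M N"]) auto
  qed
  have ev_mono: "ev Q" if "ev P" "\<And>n. P n \<Longrightarrow> Q n" for P Q
    using that unfolding ev_def by blast
  have ev_ge: "ev (\<lambda>n. N \<le> n)" for N
    unfolding ev_def by (intro exI[of _ "{}"] exI[of _ N]) auto
  have ev_mem: "ev (\<lambda>n. n \<in> D)" if "D \<in> p F" for D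
    unfolding ev_def using that by (intro exI[of _ "{D}"] exI[of _ 0]) auto
  have ev_ball: "ev (\<lambda>n. \<forall>V\<in>\<V>. Q V n)" if "finite \<V>" "\<And>V. V \<in> \<V> \<Longrightarrow> ev (Q V)"
    for \<V> :: "(nat + nat set) set set" and Q
    using that
  proof (induction \<V>)
    case empty
    then show ?case using ev_ge[of 0] by simp
  next
    case (insert V \<V>)
    then have "ev (\<lambda>n. Q V n \<and> (\<forall>V\<in>\<V>. Q V n))" by (intro ev_conj) auto
    then show ?case by simp
  qed
  have ev_ex: "\<exists>n. P n" if "ev P" for P
    using that sfip sfip_unbounded unfolding ev_def by metis
  \<comment> \<open>If \<open>R\<close> is empty, the remainders are the nonempty sets
    \<open>G (m n)\<close> themselves, and the task with \<open>Y = UNIV\<close> yields a member of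
    the limit.\<close>
  have "L \<noteq> {}"
  proof (cases "R = {}")
    case True
    then have "F n = G (m n)" for n using GR[of n] by (auto simp: F_def)
    then have "hits F UNIV = UNIV" using G(2) by (auto simp: hits_def)
    moreover have "{} \<notin> p F" using sfipD[OF sfip, of "{{}}"] by auto
    ultimately obtain a where "a \<in> A" "hits F a \<in> p F"
      using dec[OF F, of UNIV] by (auto simp: decided_def)
    then show ?thesis by (auto simp: L_def B_def)
  qed (simp add: L_def)
  moreover have "closedin (Psi A) L"
    unfolding L_def by (rule closedin_Psi) (auto simp: B_def)
  ultimately have L: "L \<in> hyperspace (Psi A)" by (simp add: hyperspace_def)
  define W where "W = {E \<in> topspace ?V. f E \<in> {x. \<bar>x\<bar> < \<bar>f L\<bar> + 1}}"
  have "open {x :: real. \<bar>x\<bar> < \<bar>f L\<bar> + 1}" by (intro open_Collect_less continuous_intros)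
  then have "openin ?V W"
    unfolding W_def by (rule openin_continuous_map_preimage[OF f, folded open_openin])
  moreover have "L \<in> W" using L by (simp add: W_def topspace_Vietoris)
  ultimately obtain U \<V> where U: "openin (Psi A) U" "L \<subseteq> U" and fin: "finite \<V>"
    and \<V>: "\<And>V. V \<in> \<V> \<Longrightarrow> openin (Psi A) V \<and> L \<inter> V \<noteq> {}"
    and UW: "\<And>E. E \<in> hyperspace (Psi A) \<Longrightarrow> E \<subseteq> U \<Longrightarrow> (\<And>V. V \<in> \<V> \<Longrightarrow> E \<inter> V \<noteq> {}) \<Longrightarrow> E \<in> W"
    by (rule Vietoris_nhd) (rule that; blast)
  \<comment> \<open>The part \<open>Y\<close> of \<omega> outside \<open>U\<close> meets each
    relevant member of \<open>A\<close> in a finite set, so \<open>decided\<close> forces the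
    remainders to avoid \<open>Y\<close> along the filter. The initial parts lie in
    \<open>R\<close>.\<close>
  have ev_U: "ev (\<lambda>n. Inl ` G (m n) \<subseteq> U)"
  proof -
    define Y where "Y = {x. Inl x \<notin> U}"
    have "finite (a \<inter> Y)" if "a \<in> A" "hits F a \<in> p F" for a
    proof -
      have "Inr a \<in> U" using that U(2) by (auto simp: L_def B_def)
      then have "finite {x \<in> a. Inl x \<notin> U}" using U(1) that by (auto simp: openin_Psi_iff)
      then show ?thesis by (rule finite_subset[rotated]) (auto simp: Y_def)
    qed
    then have "- hits F Y \<in> p F" using dec[OF F, of Y] by (auto simp: decided_def)
    then show ?thesis
    proof (rule ev_mono[OF ev_mem])
      fix n assume n: "n \<in> - hits F Y"
      have "Inl x \<in> U" if x: "x \<in> G (m n)" for x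
      proof (cases "x < k n")
        case True
        then have "x \<in> R" using GR[of n] x by blast
        then show ?thesis using U(2) by (auto simp: L_def)
      next
        case False
        then have "x \<in> F n" using x by (simp add: F_def)
        then show ?thesis using n by (auto simp: hits_def Y_def)
      qed
      then show "Inl ` G (m n) \<subseteq> U" by blast
    qed
  qed
  have ev_V: "ev (\<lambda>n. Inl ` G (m n) \<inter> V \<noteq> {})" if V: "V \<in> \<V>" for V
  proof -
    have opn: "openin (Psi A) V" using \<V> V by blast
    have near: "finite {x \<in> a. Inl x \<notin> V}" if "a \<in> A" "Inr a \<in> V" for a
      using opn that by (auto simp: openin_Psi_iff)
    have pt: "ev (\<lambda>n. Inl ` G (m n) \<inter> V \<noteq> {})" if x: "x \<in> R" "Inl x \<in> V" for x
    proof (rule ev_mono[OF ev_ge[of "Suc x"]])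
      fix n assume "Suc x \<le> n"
      then have "x < k n" using strict_mono_imp_increasing[OF k, of n] by simp
      then have "x \<in> G (m n)" using GR[of n] x by blast
      then show "Inl ` G (m n) \<inter> V \<noteq> {}" using x by blast
    qed
    \<comment> \<open>A point of \<open>R\<close> in \<open>V\<close> lies in almost every
      \<open>G (m n)\<close>, and if \<open>a\<close> meets \<open>R\<close> infinitely then
      \<open>V\<close> contains such a point. If \<open>a\<close> is hit along the filter, the
      remainder \<open>F n\<close> lies above \<open>k n \<ge> n\<close>, so for large
      \<open>n\<close> its points in \<open>a\<close> belong to \<open>V\<close>.\<close>
    obtain l where "l \<in> L" "l \<in> V" using \<V> V by blast
    then consider x where "x \<in> R" "Inl x \<in> V" | a where "a \<in> A" "Inr a \<in> V" "infinite (a \<inter> R)"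
      | a where "a \<in> A" "Inr a \<in> V" "hits F a \<in> p F"
      by (auto simp: L_def B_def)
    then show ?thesis
    proof cases
      case (1 x)
      then show ?thesis by (rule pt)
    next
      case (2 a)
      then have "\<not> a \<inter> R \<subseteq> {x \<in> a. Inl x \<notin> V}" using near finite_subset by blast
      then show ?thesis using pt by blast
    next
      case (3 a)
      obtain N where N: "\<And>x. x \<in> a \<Longrightarrow> N \<le> x \<Longrightarrow> Inl x \<in> V"
        using near[OF 3(1,2)] unfolding finite_nat_iff_bounded by (auto simp: subset_iff not_less[symmetric])
      show ?thesis
      proof (rule ev_mono[OF ev_conj[OF ev_mem[OF 3(3)] ev_ge[of N]]])
        fix n assume n: "n \<in> hits F a \<and> N \<le> n"
        then obtain x where x: "x \<in> F n" "x \<in> a" by (auto simp: hits_def)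
        have "N \<le> x" using x(1) n strict_mono_imp_increasing[OF k, of n] by (simp add: F_def)
        then show "Inl ` G (m n) \<inter> V \<noteq> {}" using N x by (auto simp: F_def)
      qed
    qed
  qed
  \<comment> \<open>On \<open>W\<close> the absolute value of \<open>f\<close> stays below
    \<open>N\<close>, while at \<open>G (m n)\<close> it exceeds \<open>m n\<close>, which is at
    least \<open>N\<close> once \<open>n \<ge> N\<close>.\<close>
  obtain N where N: "\<bar>f L\<bar> + 1 < real N" using reals_Archimedean2 by blast
  have "ev (\<lambda>n. N \<le> n \<and> Inl ` G (m n) \<subseteq> U \<and> (\<forall>V\<in>\<V>. Inl ` G (m n) \<inter> V \<noteq> {}))"
    using ev_ball[OF fin ev_V] by (intro ev_conj ev_ge ev_U)
  then obtain n where n: "N \<le> n" "Inl ` G (m n) \<subseteq> U" "\<forall>V\<in>\<V>. Inl ` G (m n) \<inter> V \<noteq> {}"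
    using ev_ex by blast
  have "Inl ` G (m n) \<in> W"
    using n by (intro UW finite_in_hyperspace_Psi G(1,2)) auto
  then have "\<bar>f (Inl ` G (m n))\<bar> < real N" using N by (simp add: W_def)
  moreover have "real N \<le> real (m n)" using n(1) strict_mono_imp_increasing[OF m, of n] by simp
  ultimately show False using G(3)[of "m n"] by linarith
qed

section \<open>Maximality and the conclusion\<close>

text \<open>Take the singletons of an infinite set \<open>x\<close> as the sequence and
  \<open>Y = x\<close>. Every term meets \<open>x\<close>, so the first alternative of
  \<open>decided\<close> would put the empty set into \<open>p C\<close>; hence some member of
  \<open>A\<close> meets \<open>x\<close> infinitely.\<close>

lemma MAD_family_decided:
  assumes good: "good A p" and dec: "\<And>C Y. finite_disjoint_seq C \<Longrightarrow> decided A (p C) C Y"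
  shows "MAD_family A"
proof -
  have ad: "ad A" using good by (simp add: good_def)
  have meet: "\<exists>a\<in>A. infinite (a \<inter> x)" if "infinite x" for x
  proof -
    define C where "C n = {enumerate x n}" for n
    have "enumerate x i \<noteq> enumerate x j" if "i \<noteq> j" for i j
      using \<open>infinite x\<close> that by (meson injD strict_mono_enumerate strict_mono_imp_inj_on)
    then have C: "finite_disjoint_seq C"
      by (auto simp: finite_disjoint_seq_def disjoint_family_on_def C_def)
    have "- hits C x = {}" using that by (auto simp: hits_def C_def enumerate_in_set)
    moreover have "{} \<notin> p C"
      using good sfipD[of "p C" "{{}}"] by (auto simp: good_def)
    ultimately show ?thesis using dec[OF C, of x] by (auto simp: decided_def)
  qed
  \<comment> \<open>If \<open>A\<close> were finite, the complement of its union would be infinite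
    by \<open>good\<close>, and a member of \<open>A\<close> would have to meet it.\<close>
  have "infinite A"
  proof
    assume A: "finite A"
    then have "infinite (- \<Union>A)" using good by (simp add: good_def)
    then obtain a where a: "a \<in> A" "infinite (a \<inter> - \<Union>A)" using meet by blast
    then have "a \<inter> - \<Union>A = {}" by blast
    then show False using a(2) by simp
  qed
  then have "almost_disjoint_family A" using ad by (simp add: almost_disjoint_family_def ad_def)
  moreover have "\<not> A \<subset> B" if B: "almost_disjoint_family B" for B
  proof
    assume "A \<subset> B"
    then obtain x where x: "x \<in> B" "x \<notin> A" "A \<subseteq> B" by blast
    then have "infinite x" using B by (simp add: almost_disjoint_family_def)
    then obtain a where a: "a \<in> A" "infinite (a \<inter> x)" using meet by blast
    then have "a \<in> B" "a \<noteq> x" using x by auto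
    then show False using a(2) x(1) B by (auto simp: almost_disjoint_family_def)
  qed
  ultimately show ?thesis unfolding MAD_family_def by blast
qed

theorem theorem5:
  assumes "ap =o continuum"
  shows "\<exists>A. MAD_family A \<and> pseudocompact_space (Vietoris (Psi A))"
proof -
  interpret ap_eq_continuum using assms by unfold_locales
  obtain A p where "good A p" "\<And>C Y. finite_disjoint_seq C \<Longrightarrow> decided A (p C) C Y"
    using decided_family_exists by blast
  then show ?thesis using MAD_family_decided pseudocompact_Vietoris_Psi by blast
qed

end
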